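(* Let $\mathrm{SWAP}=\langle 0000|+\langle 0101|+\langle 1010|+\langle 1111|\in((\mathbb{C}^2)^* )^{\otimes4}$ and let $G=\mathrm{SWAP}^{\otimes2}\in((\mathbb{C}^2)^* )^{\otimes8}$. Then $$P_{W_8}\bigl(\overline{\mathrm{SL}(2,\mathbb{C})^8.G}\bigr)\cap\mathbb{C}\mathcal{P}_8^\vee=P_{W_8}\bigl(\mathrm{GL}(2,\mathbb{C})^8.G\bigr)\cap\mathbb{C}^*\mathcal{P}_8^\vee=\emptyset.$$
   Context: Notation: $\{v_0,v_1\}$ is an orthonormal basis of $\mathbb{C}^2$ with dual basis $\{v_0^*,v_1^*\}$; $\langle i_1\cdots i_k|=v_{i_1}^*\otimes\cdots\otimes v_{i_k}^*$. For $I\subseteq[n]=\{1,\dots,n\}$, $\langle I|=\langle\chi_I(1)\cdots\chi_I(n)|$ where $\chi_I$ is the indicator function of $I$, and $\overline I=[n]\setminus I$. For an $n\times n$ skew-symmetric complex matrix $M$ let $M_I$ be the principal submatrix with rows and columns in $I$ and put $$\mathrm{sPf}^\vee_n(M)=\sum_{I\subseteq[n]}\mathrm{Pf}(M_I)\,\langle\overline I|\in((\mathbb{C}^2)^* )^{\otimes n},$$ where $\mathrm{Pf}$ of the empty matrix is $1$ and $\mathrm{Pf}$ of an odd-size matrix is $0$. $\mathcal{P}_n^\vee$ is the image of $\mathrm{sPf}_n^\vee$ (the variety of arity-$n$ Pfaffian cogates). $\mathbb{C}\mathcal{P}_n^\vee$ denotes the cone over $\mathcal{P}_n^\vee$, i.e.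 the affine variety defined by the homogeneous (Grassmann–Plücker type) relations defining $\mathcal{P}_n^\vee$ with the normalization that the coefficient of $\langle 1\cdots1|$ equals $1$ omitted; and $\mathbb{C}^*\mathcal{P}_n^\vee=\{\lambda p:\lambda\in\mathbb{C}\setminus\{0\},\ p\in\mathcal{P}_n^\vee\}$. $(g_1,\dots,g_n)\in\mathrm{GL}(2,\mathbb{C})^n$ (in particular in $\mathrm{SL}(2,\mathbb{C})^n$) acts on $((\mathbb{C}^2)^* )^{\otimes n}$ by $\phi\mapsto\phi\circ(g_1^{-1}\otimes\cdots\otimes g_n^{-1})$; the overline on an orbit denotes Zariski closure. $W_n\subset((\mathbb{C}^2)^* )^{\otimes n}$ is the subspace of tensors of even support, i.e. $\sum_{I\subseteq[n]}\beta_I\langle I|$ with $\beta_I=0$ whenever $|I|$ is odd, and $P_{W_n}:((\mathbb{C}^2)^* )^{\otimes n}\to W_n$ is the associated linear projector $\sum_I\beta_I\langle I|\mapsto\sum_{|I|\text{ even}}\beta_I\langle I|$.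
   Formalization: The zero tensor is removed from the first intersection: the cone CP_8 contains 0, and 0 is also the projection of a point of SL(2,C)^8.G (rotate one factor by a right angle), so that intersection is not literally empty; the claim is proved for all nonzero tensors. *)

theory Defs
  imports "HOL-Analysis.Analysis" "HOL-Combinatorics.Permutations"
begin

section \<open>Covariant tensors of arity n\<close>

text \<open>
  An element of the n-fold tensor power of the dual of $\mathbb{C}^2$ is represented by its family
  of coefficients in the basis $\langle I|$, where I ranges over the subsets of {1..n}; the
  coefficients at all other sets of naturals are required to vanish.
\<close>

type_synonym tensor = "nat set \<Rightarrow> complex"

definition tensors :: "nat \<Rightarrow> tensor set" where
  "tensors n = {\<beta>. \<forall>I. \<not> I \<subseteq> {1..n} \<longrightarrow> \<beta> I = 0}"

definition bra :: "nat set \<Rightarrow> tensor" where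
  "bra I = (\<lambda>J. if J = I then 1 else 0)"

text \<open>The basis tensor $\langle i_1 \cdots i_k|$ named by its bit string.\<close>

definition bra_bits :: "nat list \<Rightarrow> tensor" where
  "bra_bits bs = bra {k \<in> {1..length bs}. bs ! (k - 1) = 1}"

definition tensor_prod :: "nat \<Rightarrow> nat \<Rightarrow> tensor \<Rightarrow> tensor \<Rightarrow> tensor" where
  "tensor_prod m n \<phi> \<psi> = (\<lambda>J. if J \<subseteq> {1..m + n}
     then \<phi> (J \<inter> {1..m}) * \<psi> {j \<in> {1..n}. j + m \<in> J} else 0)"

definition SWAP :: tensor where
  "SWAP = (\<lambda>J. bra_bits [0,0,0,0] J + bra_bits [0,1,0,1] J
             + bra_bits [1,0,1,0] J + bra_bits [1,1,1,1] J)"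

definition G_SWAP :: tensor where
  "G_SWAP = tensor_prod 4 4 SWAP SWAP"


section \<open>The action of tuples of invertible matrices\<close>

text \<open>The matrix index type 2 has exactly the elements 0 and 1, which index $v_0$ and $v_1$.\<close>

definition chi :: "nat set \<Rightarrow> nat \<Rightarrow> 2" where
  "chi I k = (if k \<in> I then 1 else 0)"

text \<open>
  The coefficient of $\phi \circ (g_1^{-1} \otimes \cdots \otimes g_n^{-1})$ at I is its value on
  the tensor product of the $v_{\chi_I(k)}$, and $g_k^{-1} v_i = \sum_j (g_k^{-1})_{j i} v_j$.
\<close>

definition act :: "nat \<Rightarrow> (nat \<Rightarrow> complex^2^2) \<Rightarrow> tensor \<Rightarrow> tensor" where
  "act n g \<phi> = (\<lambda>I. if I \<subseteq> {1..n}
     then \<Sum>J\<in>Pow {1..n}. \<phi> J * (\<Prod>k=1..n. matrix_inv (g k) $ chi J k $ chi I k) else 0)"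

definition GL2 :: "(complex^2^2) set" where
  "GL2 = {A. invertible A}"

definition SL2 :: "(complex^2^2) set" where
  "SL2 = {A. det A = 1}"

definition orbit :: "nat \<Rightarrow> (complex^2^2) set \<Rightarrow> tensor \<Rightarrow> tensor set" where
  "orbit n H \<phi> = {act n g \<phi> | g. \<forall>k\<in>{1..n}. g k \<in> H}"


section \<open>Polynomial functions and Zariski closure\<close>

inductive_set poly_funs :: "nat \<Rightarrow> (tensor \<Rightarrow> complex) set" for n :: nat where
  const: "(\<lambda>\<beta>. c) \<in> poly_funs n"
| coord: "I \<subseteq> {1..n} \<Longrightarrow> (\<lambda>\<beta>. \<beta> I) \<in> poly_funs n"
| add: "f \<in> poly_funs n \<Longrightarrow> h \<in> poly_funs n \<Longrightarrow> (\<lambda>\<beta>. f \<beta> + h \<beta>) \<in> poly_funs n"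
| mult: "f \<in> poly_funs n \<Longrightarrow> h \<in> poly_funs n \<Longrightarrow> (\<lambda>\<beta>. f \<beta> * h \<beta>) \<in> poly_funs n"

definition hom_poly_funs :: "nat \<Rightarrow> nat \<Rightarrow> (tensor \<Rightarrow> complex) set" where
  "hom_poly_funs n d = {f \<in> poly_funs n.
     \<forall>c. \<forall>\<beta>\<in>tensors n. f (\<lambda>I. c * \<beta> I) = c ^ d * f \<beta>}"

definition zariski_closure :: "nat \<Rightarrow> tensor set \<Rightarrow> tensor set" where
  "zariski_closure n S = {\<beta> \<in> tensors n.
     \<forall>f\<in>poly_funs n. (\<forall>\<sigma>\<in>S. f \<sigma> = 0) \<longrightarrow> f \<beta> = 0}"


section \<open>Pfaffian cogates\<close>

text \<open>
  A matrix of size m is a function of which only the values on {1..m} \<times> {1..m} matter.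
\<close>

definition skew_symmetric :: "nat \<Rightarrow> (nat \<Rightarrow> nat \<Rightarrow> complex) \<Rightarrow> bool" where
  "skew_symmetric n M \<longleftrightarrow> (\<forall>i\<in>{1..n}. \<forall>j\<in>{1..n}. M i j = - M j i)"

definition pfaffian :: "nat \<Rightarrow> (nat \<Rightarrow> nat \<Rightarrow> complex) \<Rightarrow> complex" where
  "pfaffian m A = (if odd m then 0 else
     (\<Sum>p | p permutes {1..m}. of_int (sign p) * (\<Prod>i=1..m div 2. A (p (2 * i - 1)) (p (2 * i))))
       / (2 ^ (m div 2) * fact (m div 2)))"

definition principal_submatrix ::
    "(nat \<Rightarrow> nat \<Rightarrow> complex) \<Rightarrow> nat set \<Rightarrow> (nat \<Rightarrow> nat \<Rightarrow> complex)" where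
  "principal_submatrix M I = (\<lambda>i j. M (sorted_list_of_set I ! (i - 1)) (sorted_list_of_set I ! (j - 1)))"

definition sPf :: "nat \<Rightarrow> (nat \<Rightarrow> nat \<Rightarrow> complex) \<Rightarrow> tensor" where
  "sPf n M = (\<lambda>J. \<Sum>I\<in>Pow {1..n}.
     pfaffian (card I) (principal_submatrix M I) * bra ({1..n} - I) J)"

definition pf_cogates :: "nat \<Rightarrow> tensor set" where
  "pf_cogates n = sPf n ` {M. skew_symmetric n M}"

text \<open>
  The affine variety cut out by all homogeneous relations that hold on the Pfaffian cogates.
  It contains the zero tensor.
\<close>

definition pf_cone :: "nat \<Rightarrow> tensor set" where
  "pf_cone n = {\<beta> \<in> tensors n.
     \<forall>d. \<forall>f\<in>hom_poly_funs n d. (\<forall>p\<in>pf_cogates n. f p = 0) \<longrightarrow> f \<beta> = 0}"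

definition pf_scaled :: "nat \<Rightarrow> tensor set" where
  "pf_scaled n = {\<lambda>I. c * p I | c p. c \<noteq> 0 \<and> p \<in> pf_cogates n}"

definition even_tensors :: "nat \<Rightarrow> tensor set" where
  "even_tensors n = {\<beta> \<in> tensors n. \<forall>I. odd (card I) \<longrightarrow> \<beta> I = 0}"

definition even_proj :: "tensor \<Rightarrow> tensor" where
  "even_proj \<beta> = (\<lambda>I. if even (card I) then \<beta> I else 0)"

lemma even_proj_in_even_tensors: "\<beta> \<in> tensors n \<Longrightarrow> even_proj \<beta> \<in> even_tensors n"
  by (auto simp: even_proj_def even_tensors_def tensors_def)


section \<open>The zero tensor\<close>

text \<open>
  The zero tensor lies in the projection of the SL2-orbit of G (apply a rotation by a right angle
  in one position and the identity elsewhere: the result has odd support), and it lies in the cone.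
  So the intersection of the projected orbit closure with the cone is never literally empty, and
  the emptiness claim has to be read for nonzero tensors.
\<close>

lemma zero_in_pf_cone: "(\<lambda>I. 0) \<in> pf_cone n"
proof -
  have "f (\<lambda>I. 0) = 0" if f: "f \<in> hom_poly_funs n d" and z: "\<forall>p\<in>pf_cogates n. f p = 0" for d f
  proof -
    define p where "p = sPf n (\<lambda>i j. 0)"
    have p: "p \<in> pf_cogates n" unfolding p_def pf_cogates_def skew_symmetric_def by auto
    have "p \<in> tensors n" unfolding p_def sPf_def tensors_def bra_def by (auto intro!: sum.neutral)
    then have "f (\<lambda>I. 0 * p I) = 0 ^ d * f p" using f unfolding hom_poly_funs_def by blast
    then show ?thesis using z p by simp
  qed
  then show ?thesis by (auto simp: pf_cone_def tensors_def)
qed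

lemma bra_bits_nz:
  assumes "bra_bits bs J \<noteq> 0" shows "J = {k \<in> {1..length bs}. bs ! (k - 1) = 1}"
  using assms by (auto simp: bra_bits_def bra_def split: if_splits)

lemma SWAP_nz:
  assumes "SWAP J \<noteq> 0" shows "(1 \<in> J \<longleftrightarrow> 3 \<in> J) \<and> (2 \<in> J \<longleftrightarrow> 4 \<in> J)"
proof -
  have "bra_bits [0,0,0,0] J \<noteq> 0 \<or> bra_bits [0,1,0,1] J \<noteq> 0
      \<or> bra_bits [1,0,1,0] J \<noteq> 0 \<or> bra_bits [1,1,1,1] J \<noteq> 0"
    using assms by (auto simp: SWAP_def)
  then show ?thesis
    by (elim disjE) (drule bra_bits_nz, simp add: nth_Cons')+
qed

lemma G_SWAP_nz:
  assumes "G_SWAP J \<noteq> 0"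
  shows "J \<subseteq> {1..8} \<and> (1 \<in> J \<longleftrightarrow> 3 \<in> J) \<and> (2 \<in> J \<longleftrightarrow> 4 \<in> J) \<and> (5 \<in> J \<longleftrightarrow> 7 \<in> J) \<and> (6 \<in> J \<longleftrightarrow> 8 \<in> J)"
proof -
  have J: "J \<subseteq> {1..8}" and 1: "SWAP (J \<inter> {1..4}) \<noteq> 0" and 2: "SWAP {j \<in> {1..4}. j + 4 \<in> J} \<noteq> 0"
    using assms by (auto simp: G_SWAP_def tensor_prod_def split: if_splits)
  show ?thesis using J SWAP_nz[OF 1] SWAP_nz[OF 2] by simp
qed

lemma zero_in_projected_SL2_orbit:
  "(\<lambda>I. 0) \<in> even_proj ` orbit 8 SL2 G_SWAP"
proof -
  define R :: "complex^2^2" where "R = (\<chi> i j. if i = j then 0 else if i = 0 then 1 else -1)"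
  define g where "g = (\<lambda>k::nat. if k = 1 then R else mat 1)"
  have two: "(2::2) = 0" by simp
  have R2: "R ** (- R) = mat 1" "(- R) ** R = mat 1"
    by (auto simp: R_def matrix_matrix_mult_def mat_def vec_eq_iff forall_2 sum_2)
  have dR: "det R = 1" by (simp add: R_def det_2 two)
  have uniq: "B = C" if "A ** B = mat 1" "C ** A = mat 1" for A B C :: "complex^2^2"
    using that by (metis matrix_mul_assoc matrix_mul_lid matrix_mul_rid)
  have inv_eq: "matrix_inv A = B" if "A ** B = mat 1" "B ** A = mat 1" for A B :: "complex^2^2"
  proof -
    have "A ** matrix_inv A = mat 1 \<and> matrix_inv A ** A = mat 1"
      unfolding matrix_inv_def by (rule someI[of _ B]) (use that in auto)
    then show ?thesis using that uniq by blast
  qed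
  have iR: "matrix_inv R = - R" by (rule inv_eq) (use R2 in auto)
  have iI: "matrix_inv (mat 1 :: complex^2^2) = mat 1" by (rule inv_eq) auto
  have zero: "G_SWAP J * (\<Prod>k=1..8. matrix_inv (g k) $ chi J k $ chi I k) = 0"
    if I: "I \<subseteq> {1..8}" "even (card I)" for I J
  proof (rule ccontr)
    assume nz: "\<not> ?thesis"
    then have GJ: "G_SWAP J \<noteq> 0" by simp
    have pk: "matrix_inv (g k) $ chi J k $ chi I k \<noteq> 0" if "k \<in> {1..8}" for k
      using nz that by (auto simp: prod_zero_iff)
    have s1: "1 \<in> I \<longleftrightarrow> 1 \<notin> J"
    proof -
      have "(- R) $ chi J 1 $ chi I 1 \<noteq> 0" using pk[of 1] by (simp add: g_def iR)
      then show ?thesis by (auto simp: R_def chi_def split: if_splits)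
    qed
    have sk: "k \<in> I \<longleftrightarrow> k \<in> J" if "k \<in> {2..8}" for k
    proof -
      have "(mat 1 :: complex^2^2) $ chi J k $ chi I k \<noteq> 0"
        using pk[of k] that by (simp add: g_def iI)
      then show ?thesis by (auto simp: mat_def chi_def split: if_splits)
    qed
    have b: "1 \<in> I \<longleftrightarrow> 3 \<notin> I" "2 \<in> I \<longleftrightarrow> 4 \<in> I" "5 \<in> I \<longleftrightarrow> 7 \<in> I" "6 \<in> I \<longleftrightarrow> 8 \<in> I"
      using s1 sk[of 2] sk[of 3] sk[of 4] sk[of 5] sk[of 6] sk[of 7] sk[of 8] G_SWAP_nz[OF GJ] by auto
    have "card I = (\<Sum>k\<in>{1..8}. if k \<in> I then 1 else 0)"
      using I(1) by (simp add: sum.If_cases Int_absorb1 Int_def[symmetric])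
    also have "{1..8::nat} = {1,2,3,4,5,6,7,8}" by auto
    finally have "card I = (\<Sum>k\<in>{1,2,3,4,5,6,7,8}. if k \<in> I then 1 else 0)" .
    then have "odd (card I)" using b by (auto split: if_splits)
    then show False using I(2) by simp
  qed
  have "even_proj (act 8 g G_SWAP) = (\<lambda>I. 0)"
    unfolding even_proj_def act_def using zero by (auto intro!: ext sum.neutral)
  moreover have "act 8 g G_SWAP \<in> orbit 8 SL2 G_SWAP"
    unfolding orbit_def SL2_def g_def using dR by force
  ultimately show ?thesis by (metis image_eqI)
qed

end

theory Submission
  imports Defs
begin

text \<open>
  Every tensor in the Zariski closure of the $\mathrm{SL}_2$-orbit of G, and in the $\mathrm{GL}_2$-orbit, is a
  product $B_1(x_1,x_3) B_2(x_2,x_4) B_3(x_5,x_7) B_4(x_6,x_8)$ of nondegenerate bilinear forms.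
  Write $A_i$ and $C_i$ for the products of the diagonal and of the antidiagonal entries of $B_i$, so that
  $A_i \neq C_i$. The four-term Pfaffian relations in the interleaved positions 1, 2, 3, 4 say that
  $A_1 A_2 = C_1 C_2$ as soon as $B_3 \otimes B_4$ has a suitable nonzero entry of even weight, and
  $C_1 A_2 = A_1 C_2$ as soon as it has one of odd weight; likewise in positions 5, 6, 7, 8. If both
  equations hold then $A_i = - C_i \neq 0$ for all i, all entries are nonzero, and the relation in
  positions 1, 2, 3, 5 forces $A_1 = C_1$, a contradiction. Otherwise every $B_i$ is purely diagonal or purely
  antidiagonal with an odd number of antidiagonal ones, and the even part of the product vanishes.
  The relations are needed only for Pfaffians of size at most six, because a base of size four would
  occur only in a case already settled.
\<close>

section \<open>Pfaffians of size at most six\<close>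

text \<open>The permutation sum of \<open>pfaffian\<close> without its normalizing factor, indexed
  by half the size so that it obeys a recursion in \<open>Suc m\<close>.\<close>

definition pf_sum :: "nat \<Rightarrow> (nat \<Rightarrow> nat \<Rightarrow> complex) \<Rightarrow> complex" where
  "pf_sum m A = (\<Sum>p | p permutes {1..2 * m}.
     of_int (sign p) * (\<Prod>i=1..m. A (p (2 * i - 1)) (p (2 * i))))"

lemma pfaffian_eq_pf_sum: "pfaffian (2 * m) A = pf_sum m A / (2 ^ m * fact m)"
  by (simp add: pfaffian_def pf_sum_def)

text \<open>A permutation of the larger set is uniquely \<open>t \<circ> q\<close>, where
  \<open>t\<close> is built from two transpositions that move the top two positions and
  \<open>q\<close> permutes the remaining ones. As \<open>q\<close> fixes the top two positions, the
  last factor depends on \<open>t\<close> alone and the sum over \<open>q\<close> is the smaller sum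
  of the reindexed matrix.\<close>

lemma pf_sum_Suc:
  "pf_sum (Suc m) A = (\<Sum>b\<in>{1..2 * m + 2}. \<Sum>c\<in>{1..2 * m + 1}.
     let t = Transposition.transpose (2 * m + 2) b \<circ> Transposition.transpose (2 * m + 1) c in
     of_int (sign t) * A (t (2 * m + 1)) (t (2 * m + 2)) * pf_sum m (\<lambda>x y. A (t x) (t y)))"
proof -
  let ?N = "{1..2 * m}" and ?a = "2 * m + 1" and ?z = "2 * m + 2"
  let ?F = "\<lambda>p. of_int (sign p) * (\<Prod>i=1..Suc m. A (p (2 * i - 1)) (p (2 * i)))"
  have N1: "{1..2 * m + 1} = insert ?a ?N" and N2: "{1..2 * m + 2} = insert ?z (insert ?a ?N)" by auto
  have f1: "finite (insert ?a ?N)" "?z \<notin> insert ?a ?N" and f2: "finite ?N" "?a \<notin> ?N" by auto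
  have "pf_sum (Suc m) A = sum ?F {p. p permutes insert ?z (insert ?a ?N)}"
    unfolding pf_sum_def N2[symmetric] by (simp only: mult_Suc_right add.commute)
  also have "\<dots> = (\<Sum>b\<in>insert ?z (insert ?a ?N). \<Sum>c\<in>insert ?a ?N. \<Sum>q | q permutes ?N.
      ?F (Transposition.transpose ?z b \<circ> (Transposition.transpose ?a c \<circ> q)))"
    by (simp only: sum_over_permutations_insert[OF f1] sum_over_permutations_insert[OF f2])
  also have "\<dots> = (\<Sum>b\<in>insert ?z (insert ?a ?N). \<Sum>c\<in>insert ?a ?N.
     let t = Transposition.transpose ?z b \<circ> Transposition.transpose ?a c in
     of_int (sign t) * A (t ?a) (t ?z) * pf_sum m (\<lambda>x y. A (t x) (t y)))"
  proof (intro sum.cong refl)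
    fix b c
    define t where "t = Transposition.transpose ?z b \<circ> Transposition.transpose ?a c"
    have pt: "permutation t" unfolding t_def
      by (intro permutation_compose permutation_swap_id)
    have F: "?F (Transposition.transpose ?z b \<circ> (Transposition.transpose ?a c \<circ> q)) =
        (of_int (sign t) * A (t ?a) (t ?z)) *
        (of_int (sign q) * (\<Prod>i=1..m. A (t (q (2 * i - 1))) (t (q (2 * i)))))"
      if q: "q permutes ?N" for q
    proof -
      have "sign (t \<circ> q) = sign t * sign q"
        using pt q by (intro sign_compose) (auto intro: permutes_imp_permutation)
      moreover have "q ?a = ?a" "q ?z = ?z" using q by (auto simp: permutes_def)
      moreover have "Transposition.transpose ?z b \<circ> (Transposition.transpose ?a c \<circ> q) = t \<circ> q"
        by (simp add: t_def o_assoc)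
      ultimately show ?thesis by simp
    qed
    have "(\<Sum>q | q permutes ?N. ?F (Transposition.transpose ?z b \<circ> (Transposition.transpose ?a c \<circ> q))) =
      (\<Sum>q | q permutes ?N. (of_int (sign t) * A (t ?a) (t ?z)) *
        (of_int (sign q) * (\<Prod>i=1..m. A (t (q (2 * i - 1))) (t (q (2 * i))))))"
      by (rule sum.cong[OF refl], elim CollectE, rule F)
    also have "\<dots> = of_int (sign t) * A (t ?a) (t ?z) * pf_sum m (\<lambda>x y. A (t x) (t y))"
      by (simp only: pf_sum_def sum_distrib_left)
    finally show "(\<Sum>q | q permutes ?N. ?F (Transposition.transpose ?z b \<circ> (Transposition.transpose ?a c \<circ> q))) =
      (let t = Transposition.transpose ?z b \<circ> Transposition.transpose ?a c in
       of_int (sign t) * A (t ?a) (t ?z) * pf_sum m (\<lambda>x y. A (t x) (t y)))"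
      by (simp only: Let_def t_def)
  qed
  finally show ?thesis unfolding N1 N2 .
qed

lemma pf_sum_0: "pf_sum 0 A = 1"
  by (simp add: pf_sum_def)

definition pf4 :: "(nat \<Rightarrow> nat \<Rightarrow> complex) \<Rightarrow> nat \<Rightarrow> nat \<Rightarrow> nat \<Rightarrow> nat \<Rightarrow> complex" where
  "pf4 M a b c d = M a b * M c d - M a c * M b d + M a d * M b c"

text \<open>Expansion of the size-six Pfaffian along row \<open>a\<close>.\<close>

definition pf6 :: "(nat \<Rightarrow> nat \<Rightarrow> complex) \<Rightarrow>
    nat \<Rightarrow> nat \<Rightarrow> nat \<Rightarrow> nat \<Rightarrow> nat \<Rightarrow> nat \<Rightarrow> complex" where
  "pf6 M a b c d e f = M a b * pf4 M c d e f - M a c * pf4 M b d e f + M a d * pf4 M b c e f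
     - M a e * pf4 M b c d f + M a f * pf4 M b c d e"

lemma skew_symmetricD:
  "skew_symmetric n M \<Longrightarrow> i \<in> {1..n} \<Longrightarrow> j \<in> {1..n} \<Longrightarrow> M i j = - M j i"
  unfolding skew_symmetric_def by blast

lemma pf_sum_1: assumes "A 2 1 = - A 1 2" shows "pf_sum 1 A = 2 * A 1 2"
proof -
  have s: "{1..2::nat} = {1,2}" "{1..1::nat} = {1}" "2 * 0 + 2 = (2::nat)"
    "2 * 0 + 1 = (1::nat)" "Suc 0 = 1" by auto
  show ?thesis
    using assms unfolding pf_sum_Suc[of 0 A, unfolded s]
    by (simp add: pf_sum_0 Let_def sign_swap_id sign_compose permutation_swap_id
        Transposition.transpose_def del: One_nat_def)
qed

lemma pf_sum_2: assumes "skew_symmetric 4 A" shows "pf_sum 2 A = 8 * pf4 A 1 2 3 4"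
proof -
  have s: "{1..4::nat} = {1,2,3,4}" "{1..3::nat} = {1,2,3}" "Suc 1 = 2" 
     "2 * 1 + 2 = (4::nat)" "2 * 1 + 1 = (3::nat)" by auto
  have k: "A 2 1 = - A 1 2" "A 3 1 = - A 1 3" "A 3 2 = - A 2 3" "A 4 1 = - A 1 4" "A 4 2 = - A 2 4" "A 4 3 = - A 3 4"
    by (rule skew_symmetricD[OF assms]; simp)+
  show ?thesis
    unfolding pf_sum_Suc[of 1 A, unfolded s]
    by (simp add: pf_sum_1 k Let_def sign_swap_id sign_compose permutation_swap_id
        Transposition.transpose_def pf4_def algebra_simps del: One_nat_def)
qed

text \<open>The recursion leaves reindexed size-four sums, each evaluated by
  \<open>pf_sum_2\<close>. The constants 2, 8 and 48 are 2^m m! for m = 1, 2, 3 and cancel the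
  normalization in \<open>pfaffian\<close>.\<close>

lemma pf_sum_3: assumes "skew_symmetric 6 A" shows "pf_sum 3 A = 48 * pf6 A 1 2 3 4 5 6"
proof -
  have s: "{1..6::nat} = {1,2,3,4,5,6}" "{1..5::nat} = {1,2,3,4,5}" "Suc 2 = 3" 
     "2 * 2 + 2 = (6::nat)" "2 * 2 + 1 = (5::nat)" by auto
  have k: "A 2 1 = - A 1 2" "A 3 1 = - A 1 3" "A 3 2 = - A 2 3" "A 4 1 = - A 1 4" "A 4 2 = - A 2 4" "A 4 3 = - A 3 4" "A 5 1 = - A 1 5" "A 5 2 = - A 2 5" "A 5 3 = - A 3 5" "A 5 4 = - A 4 5" "A 6 1 = - A 1 6" "A 6 2 = - A 2 6" "A 6 3 = - A 3 6" "A 6 4 = - A 4 6" "A 6 5 = - A 5 6"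
    by (rule skew_symmetricD[OF assms]; simp)+
  \<comment> \<open>Skewness passes to each reindexed matrix because \<open>t\<close> maps the first
    four positions into {1..6}.\<close>
  have "skew_symmetric 4 (\<lambda>x y. A (t x) (t y))"
    if "b \<in> {1..6}" "c \<in> {1..5}" "t = Transposition.transpose 6 b \<circ> Transposition.transpose 5 c" for b c t
  proof -
    have "t x \<in> {1..6}" if "x \<in> {1..4}" for x
      using \<open>b \<in> _\<close> \<open>c \<in> _\<close> \<open>t = _\<close> that by (auto simp: Transposition.transpose_def)
    then show ?thesis
      unfolding skew_symmetric_def using skew_symmetricD[OF assms] by blast
  qed
  then have "pf_sum 3 A = (\<Sum>b\<in>{1..6}. \<Sum>c\<in>{1..5}.
     let t = Transposition.transpose 6 b \<circ> Transposition.transpose 5 c in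
     of_int (sign t) * A (t 5) (t 6) * (8 * pf4 (\<lambda>x y. A (t x) (t y)) 1 2 3 4))"
    using pf_sum_Suc[of 2 A] unfolding s(3-) Let_def by (auto intro!: sum.cong simp: pf_sum_2 )
  also have "\<dots> = 48 * pf6 A 1 2 3 4 5 6"
    unfolding s Let_def
    by (simp add: k sign_swap_id sign_compose permutation_swap_id
        Transposition.transpose_def pf6_def pf4_def algebra_simps del: One_nat_def)
  finally show ?thesis .
qed

section \<open>Principal sub-Pfaffians and the coefficients of a cogate\<close>

definition sub_pf :: "(nat \<Rightarrow> nat \<Rightarrow> complex) \<Rightarrow> nat set \<Rightarrow> complex" where
  "sub_pf M I = pfaffian (card I) (principal_submatrix M I)"

lemma skew_symmetric_principal_submatrix:
  assumes "skew_symmetric n M" "I \<subseteq> {1..n}"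
  shows "skew_symmetric (card I) (principal_submatrix M I)"
proof -
  have fin: "finite I" using assms(2) finite_subset by blast
  have "sorted_list_of_set I ! (i - 1) \<in> {1..n}" if "i \<in> {1..card I}" for i
  proof -
    have "i - 1 < length (sorted_list_of_set I)" using that by auto
    then show ?thesis using nth_mem[of "i - 1" "sorted_list_of_set I"] assms(2) fin by auto
  qed
  then show ?thesis
    unfolding skew_symmetric_def principal_submatrix_def using skew_symmetricD[OF assms(1)] by blast
qed

lemma sub_pf_odd: "odd (card I) \<Longrightarrow> sub_pf M I = 0"
  by (simp add: sub_pf_def pfaffian_def)

lemma sub_pf_0: "sub_pf M {} = 1"
  using pfaffian_eq_pf_sum[of 0] by (simp add: sub_pf_def pf_sum_0)

lemma sub_pf_2:
  assumes "skew_symmetric n M" "{a, b} \<subseteq> {1..n}" "a < b"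
  shows "sub_pf M {a, b} = M a b"
proof -
  have c: "card {a, b} = 2 * 1" using assms(3) by auto
  have l: "sorted_list_of_set {a, b} = [a, b]" using assms(3) by (simp add: insort_is_Cons)
  have "M b a = - M a b" using skew_symmetricD[OF assms(1)] assms(2) by blast
  then show ?thesis
    unfolding sub_pf_def c pfaffian_eq_pf_sum by (subst pf_sum_1) (simp_all add: principal_submatrix_def l)
qed

lemma sub_pf_4:
  assumes "skew_symmetric n M" "{a, b, c, d} \<subseteq> {1..n}" "a < b" "b < c" "c < d"
  shows "sub_pf M {a, b, c, d} = pf4 M a b c d"
proof -
  have k: "card {a, b, c, d} = 2 * 2" using assms(3-) by auto
  have l: "sorted_list_of_set {a, b, c, d} = [a, b, c, d]" using assms(3-) by (simp add: insort_is_Cons)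
  have "skew_symmetric 4 (principal_submatrix M {a, b, c, d})"
    using skew_symmetric_principal_submatrix[OF assms(1,2)] k by simp
  then show ?thesis
    unfolding sub_pf_def k pfaffian_eq_pf_sum
    by (simp add: pf_sum_2 principal_submatrix_def l pf4_def fact_numeral)
qed

lemma sub_pf_6:
  assumes "skew_symmetric n M" "{a, b, c, d, e, f} \<subseteq> {1..n}" "a < b" "b < c" "c < d" "d < e" "e < f"
  shows "sub_pf M {a, b, c, d, e, f} = pf6 M a b c d e f"
proof -
  have k: "card {a, b, c, d, e, f} = 2 * 3" using assms(3-) by auto
  have l: "sorted_list_of_set {a, b, c, d, e, f} = [a, b, c, d, e, f]"
    using assms(3-) by (simp add: insort_is_Cons)
  have "skew_symmetric 6 (principal_submatrix M {a, b, c, d, e, f})"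
    using skew_symmetric_principal_submatrix[OF assms(1,2)] k by simp
  then show ?thesis
    unfolding sub_pf_def k pfaffian_eq_pf_sum
    by (simp add: pf_sum_3 principal_submatrix_def l pf6_def pf4_def fact_numeral)
qed

lemma sPf_apply:
  "sPf n M J = (if J \<subseteq> {1..n} then sub_pf M ({1..n} - J) else 0)"
proof -
  \<comment> \<open>Complementation is an involution on the subsets of {1..n}, so only the summand
    for the complement of \<open>J\<close> survives.\<close>
  have "sPf n M J = (\<Sum>I\<in>Pow {1..n}. if I = {1..n} - J \<and> J \<subseteq> {1..n} then sub_pf M I else 0)"
    unfolding sPf_def bra_def sub_pf_def by (intro sum.cong refl) auto
  then show ?thesis by (auto simp: sum.delta')
qed

lemma sPf_tensors: "sPf n M \<in> tensors n"
  by (simp add: tensors_def sPf_apply)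

section \<open>Four-term relations between sub-Pfaffians\<close>

text \<open>
  The relation Pf(R) Pf(R + abcd) = Pf(R + ab) Pf(R + cd) - Pf(R + ac) Pf(R + bd) + Pf(R + ad) Pf(R + bc)
  and its analogue for bases R of odd size, evaluated at $F(X) = \mathrm{Pf}(R + X)$. Both are invariant under
  complementation inside $\{a, b, c, d\}$, hence hold in the same form for the coefficients of a cogate.
\<close>

definition even_rel :: "nat \<Rightarrow> nat \<Rightarrow> nat \<Rightarrow> nat \<Rightarrow> (nat set \<Rightarrow> complex) \<Rightarrow> complex" where
  "even_rel a b c d F = F {} * F {a, b, c, d} - F {a, b} * F {c, d} + F {a, c} * F {b, d} - F {a, d} * F {b, c}"

definition odd_rel :: "nat \<Rightarrow> nat \<Rightarrow> nat \<Rightarrow> nat \<Rightarrow> (nat set \<Rightarrow> complex) \<Rightarrow> complex" where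
  "odd_rel a b c d F = F {a} * F {b, c, d} - F {b} * F {a, c, d} + F {c} * F {a, b, d} - F {d} * F {a, b, c}"

text \<open>Lists a small base set in increasing order, the form that \<open>sub_pf_2\<close>,
  \<open>sub_pf_4\<close> and \<open>sub_pf_6\<close> require.\<close>

lemma card_le_3_sortedE:
  fixes R :: "nat set"
  assumes "finite R" "card R \<le> 3"
  obtains "R = {}" | e where "R = {e}" | e f where "R = {e, f}" "e < f"
  | e f g where "R = {e, f, g}" "e < f" "f < g"
proof -
  define xs where "xs = sorted_list_of_set R"
  have xs: "R = set xs" "sorted_wrt (<) xs" "length xs \<le> 3" using assms by (auto simp: xs_def)
  show ?thesis
  proof (cases xs)
    case Nil then show ?thesis using xs that by simp
  next
    case (Cons e ys)
    show ?thesis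
    proof (cases ys)
      case Nil then show ?thesis using xs Cons that by simp
    next
      case (Cons f zs)
      then have "zs = [] \<or> (\<exists>g. zs = [g])" using xs \<open>xs = e # ys\<close> by (cases zs) auto
      then show ?thesis using that xs \<open>xs = e # ys\<close> Cons by auto
    qed
  qed
qed

text \<open>Sub-Pfaffians of odd size vanish, and those of even size that occur have size at most
  six, so each is an explicit polynomial. With \<open>R\<close> beyond \<open>d\<close> every union
  is already sorted. Depending on the parity of \<open>card R\<close>, one relation vanishes term by
  term and the other is a polynomial identity in the entries of \<open>M\<close>.\<close>

lemma sub_pf_rel_above:
  assumes M: "skew_symmetric n M" and Q: "{a, b, c, d} \<subseteq> {1..n}" "a < b" "b < c" "c < d"
    and R: "R \<subseteq> {1..n}" "card R \<le> 3" "\<forall>r\<in>R. d < r"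
  shows "even_rel a b c d (\<lambda>X. sub_pf M (X \<union> R)) = 0" "odd_rel a b c d (\<lambda>X. sub_pf M (X \<union> R)) = 0"
proof -
  have fin: "finite R" using R(1) finite_subset by blast
  have "even_rel a b c d (\<lambda>X. sub_pf M (X \<union> R)) = 0 \<and> odd_rel a b c d (\<lambda>X. sub_pf M (X \<union> R)) = 0"
    using fin R(2)
  proof (cases rule: card_le_3_sortedE)
    case 1
    then show ?thesis using Q
      by (simp add: even_rel_def odd_rel_def sub_pf_0 sub_pf_odd sub_pf_2[OF M] sub_pf_4[OF M] pf4_def del: Un_insert_right)
  next
    case (2 e)
    then show ?thesis using Q R
      by (simp add: even_rel_def odd_rel_def sub_pf_odd sub_pf_2[OF M] sub_pf_4[OF M] pf4_def algebra_simps del: Un_insert_right)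
  next
    case (3 e f)
    then show ?thesis using Q R
      by (simp add: even_rel_def odd_rel_def sub_pf_odd sub_pf_2[OF M] sub_pf_4[OF M] sub_pf_6[OF M] pf4_def pf6_def algebra_simps del: Un_insert_right)
  next
    case (4 e f g)
    then show ?thesis using Q R
      by (simp add: even_rel_def odd_rel_def sub_pf_odd sub_pf_4[OF M] sub_pf_6[OF M] pf4_def pf6_def algebra_simps del: Un_insert_right)
  qed
  then show "even_rel a b c d (\<lambda>X. sub_pf M (X \<union> R)) = 0" "odd_rel a b c d (\<lambda>X. sub_pf M (X \<union> R)) = 0"
    by simp_all
qed

text \<open>The mirror case, for relations in positions 5, 6, 7, 8 with a base inside
  {1..4}.\<close>

lemma sub_pf_rel_below:
  assumes M: "skew_symmetric n M" and Q: "{a, b, c, d} \<subseteq> {1..n}" "a < b" "b < c" "c < d"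
    and R: "R \<subseteq> {1..n}" "card R \<le> 3" "\<forall>r\<in>R. r < a"
  shows "even_rel a b c d (\<lambda>X. sub_pf M (R \<union> X)) = 0" "odd_rel a b c d (\<lambda>X. sub_pf M (R \<union> X)) = 0"
proof -
  have fin: "finite R" using R(1) finite_subset by blast
  have "even_rel a b c d (\<lambda>X. sub_pf M (R \<union> X)) = 0 \<and> odd_rel a b c d (\<lambda>X. sub_pf M (R \<union> X)) = 0"
    using fin R(2)
  proof (cases rule: card_le_3_sortedE)
    case 1
    then show ?thesis using Q
      by (simp add: even_rel_def odd_rel_def sub_pf_0 sub_pf_odd sub_pf_2[OF M] sub_pf_4[OF M] pf4_def del: Un_insert_right)
  next
    case (2 e)
    then show ?thesis using Q R
      by (simp add: even_rel_def odd_rel_def sub_pf_odd sub_pf_2[OF M] sub_pf_4[OF M] pf4_def algebra_simps del: Un_insert_right)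
  next
    case (3 e f)
    then show ?thesis using Q R
      by (simp add: even_rel_def odd_rel_def sub_pf_odd sub_pf_2[OF M] sub_pf_4[OF M] sub_pf_6[OF M] pf4_def pf6_def algebra_simps del: Un_insert_right)
  next
    case (4 e f g)
    then show ?thesis using Q R
      by (simp add: even_rel_def odd_rel_def sub_pf_odd sub_pf_4[OF M] sub_pf_6[OF M] pf4_def pf6_def algebra_simps del: Un_insert_right)
  qed
  then show "even_rel a b c d (\<lambda>X. sub_pf M (R \<union> X)) = 0" "odd_rel a b c d (\<lambda>X. sub_pf M (R \<union> X)) = 0"
    by simp_all
qed

section \<open>Four-term relations on the Pfaffian cone\<close>

lemma poly_funs_diff:
  assumes "f \<in> poly_funs n" "h \<in> poly_funs n" shows "(\<lambda>\<beta>. f \<beta> - h \<beta>) \<in> poly_funs n"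
  using poly_funs.add[OF assms(1) poly_funs.mult[OF poly_funs.const[of "-1"] assms(2)]] by simp

lemma poly_funs_sum:
  assumes "\<And>x. x \<in> A \<Longrightarrow> f x \<in> poly_funs n" shows "(\<lambda>\<beta>. \<Sum>x\<in>A. f x \<beta>) \<in> poly_funs n"
  using assms by (induction A rule: infinite_finite_induct) (auto intro: poly_funs.intros)

lemma pf_coneD:
  assumes "\<beta> \<in> pf_cone n" "f \<in> hom_poly_funs n d" "\<And>p. p \<in> pf_cogates n \<Longrightarrow> f p = 0"
  shows "f \<beta> = 0"
  using assms unfolding pf_cone_def by blast

lemma even_rel_hom_poly:
  assumes "S \<subseteq> {1..n}" "{a, b, c, d} \<subseteq> {1..n}"
  shows "(\<lambda>\<beta>. even_rel a b c d (\<lambda>X. \<beta> (S \<union> X))) \<in> hom_poly_funs n 2"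
proof -
  have "(\<lambda>\<beta>. even_rel a b c d (\<lambda>X. \<beta> (S \<union> X))) \<in> poly_funs n"
    unfolding even_rel_def
    by (intro poly_funs.add poly_funs_diff poly_funs.mult poly_funs.coord) (use assms in auto)
  then show ?thesis
    by (simp add: hom_poly_funs_def even_rel_def power2_eq_square algebra_simps)
qed

lemma odd_rel_hom_poly:
  assumes "S \<subseteq> {1..n}" "{a, b, c, d} \<subseteq> {1..n}"
  shows "(\<lambda>\<beta>. odd_rel a b c d (\<lambda>X. \<beta> (S \<union> X))) \<in> hom_poly_funs n 2"
proof -
  have "(\<lambda>\<beta>. odd_rel a b c d (\<lambda>X. \<beta> (S \<union> X))) \<in> poly_funs n"
    unfolding odd_rel_def
    by (intro poly_funs.add poly_funs_diff poly_funs.mult poly_funs.coord) (use assms in auto)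
  then show ?thesis
    by (simp add: hom_poly_funs_def odd_rel_def power2_eq_square algebra_simps)
qed

lemma rel_complement:
  assumes "a < b" "b < c" "c < d"
  shows "even_rel a b c d (\<lambda>X. F ({a, b, c, d} - X)) = even_rel a b c d F"
    "odd_rel a b c d (\<lambda>X. F ({a, b, c, d} - X)) = odd_rel a b c d F"
  using assms by (simp_all add: even_rel_def odd_rel_def insert_Diff_if)

lemma rel_cong:
  assumes "\<And>X. X \<subseteq> {a, b, c, d} \<Longrightarrow> F X = G X"
  shows "even_rel a b c d F = even_rel a b c d G" "odd_rel a b c d F = odd_rel a b c d G"
  unfolding even_rel_def odd_rel_def by (simp_all add: assms)

text \<open>The relations are homogeneous quadrics, so they hold on the cone once they hold on the
  cogates. The coefficient of a cogate at \<open>S \<union> X\<close> is the Pfaffian on the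
  complement, which consists of the base \<open>R\<close> and the complement of \<open>X\<close> in
  {a, b, c, d}; \<open>rel_complement\<close> absorbs the latter complementation.\<close>

lemma pf_cone_rel:
  assumes \<beta>: "\<beta> \<in> pf_cone n" and Q: "{a, b, c, d} \<subseteq> {1..n}" "a < b" "b < c" "c < d"
    and S: "S \<subseteq> {1..n}" "S \<inter> {a, b, c, d} = {}"
    and R: "R = {1..n} - {a, b, c, d} - S" "card R \<le> 3" "(\<forall>r\<in>R. d < r) \<or> (\<forall>r\<in>R. r < a)"
  shows "even_rel a b c d (\<lambda>X. \<beta> (S \<union> X)) = 0" "odd_rel a b c d (\<lambda>X. \<beta> (S \<union> X)) = 0"
proof -
  have "even_rel a b c d (\<lambda>X. p (S \<union> X)) = 0 \<and> odd_rel a b c d (\<lambda>X. p (S \<union> X)) = 0"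
    if p: "p \<in> pf_cogates n" for p
  proof -
    obtain M where M: "skew_symmetric n M" "p = sPf n M" using p by (auto simp: pf_cogates_def)
    have c: "p (S \<union> X) = sub_pf M (({a, b, c, d} - X) \<union> R)" if X: "X \<subseteq> {a, b, c, d}" for X
    proof -
      have "{1..n} - (S \<union> X) = ({a, b, c, d} - X) \<union> R" "S \<union> X \<subseteq> {1..n}"
        using R(1) X S Q(1) by blast+
      then show ?thesis by (simp add: M sPf_apply)
    qed
    have "R \<subseteq> {1..n}" using R(1) by blast
    then have "even_rel a b c d (\<lambda>X. sub_pf M (X \<union> R)) = 0 \<and> odd_rel a b c d (\<lambda>X. sub_pf M (X \<union> R)) = 0"
      using R(3) sub_pf_rel_above[OF M(1) Q _ R(2)] sub_pf_rel_below[OF M(1) Q _ R(2)]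
      unfolding Un_commute[of R] by argo
    then show ?thesis
      using rel_complement[OF Q(2-), of "\<lambda>X. sub_pf M (X \<union> R)"] rel_cong[OF c] by simp
  qed
  then show "even_rel a b c d (\<lambda>X. \<beta> (S \<union> X)) = 0" "odd_rel a b c d (\<lambda>X. \<beta> (S \<union> X)) = 0"
    using pf_coneD[OF \<beta> even_rel_hom_poly[OF S(1) Q(1)]] pf_coneD[OF \<beta> odd_rel_hom_poly[OF S(1) Q(1)]]
    by simp_all
qed

lemma pf_scaled_subset_pf_cone: "pf_scaled n \<subseteq> pf_cone n"
proof
  fix q assume "q \<in> pf_scaled n"
  then obtain c p where q: "q = (\<lambda>I. c * p I)" "p \<in> pf_cogates n" by (auto simp: pf_scaled_def)
  then have p: "p \<in> tensors n" using sPf_tensors by (auto simp: pf_cogates_def)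
  have "f q = 0" if "f \<in> hom_poly_funs n d" "\<forall>p\<in>pf_cogates n. f p = 0" for f d
  proof -
    have "f q = c ^ d * f p" using that(1) p unfolding q(1) hom_poly_funs_def by blast
    then show ?thesis using that(2) q(2) by simp
  qed
  moreover have "q \<in> tensors n" using p q(1) by (simp add: tensors_def)
  ultimately show "q \<in> pf_cone n" unfolding pf_cone_def by blast
qed

text \<open>The coefficient at {1..n} is \<open>c\<close> times the Pfaffian of the empty matrix,
  that is \<open>c\<close>.\<close>

lemma zero_notin_pf_scaled: "(\<lambda>I. 0) \<notin> pf_scaled n"
proof
  assume "(\<lambda>I. 0) \<in> pf_scaled n"
  then obtain c M where c: "c \<noteq> 0" "(\<lambda>I. 0) = (\<lambda>I. c * sPf n M I)"
    by (auto simp: pf_scaled_def pf_cogates_def)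
  have "c * sPf n M {1..n} = 0" using fun_cong[OF c(2), of "{1..n}"] by simp
  then show False using c(1) by (simp add: sPf_apply sub_pf_0)
qed

section \<open>Products of four bilinear forms on the Pfaffian cone\<close>

text \<open>
  SWAP pairs position 1 with 3 and 2 with 4, so the orbit of its square consists of products of four
  bilinear forms in the positions (1, 3), (2, 4), (5, 7), (6, 8).
\<close>

definition pair_prod ::
  "(bool \<Rightarrow> bool \<Rightarrow> complex) \<Rightarrow> (bool \<Rightarrow> bool \<Rightarrow> complex) \<Rightarrow> (bool \<Rightarrow> bool \<Rightarrow> complex) \<Rightarrow>
   (bool \<Rightarrow> bool \<Rightarrow> complex) \<Rightarrow> nat set \<Rightarrow> complex" where
  "pair_prod B1 B2 B3 B4 J =
     B1 (1 \<in> J) (3 \<in> J) * B2 (2 \<in> J) (4 \<in> J) * B3 (5 \<in> J) (7 \<in> J) * B4 (6 \<in> J) (8 \<in> J)"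

definition diag_prod :: "(bool \<Rightarrow> bool \<Rightarrow> complex) \<Rightarrow> complex" where
  "diag_prod B = B False False * B True True"

definition antidiag_prod :: "(bool \<Rightarrow> bool \<Rightarrow> complex) \<Rightarrow> complex" where
  "antidiag_prod B = B False True * B True False"

text \<open>Nondegeneracy gives each form two nonzero diagonal or two nonzero antidiagonal entries.
  A nonzero diagonal of one form kills the diagonal of the other, whose antidiagonal is then nonzero
  and kills that of the first. The entry at \<open>True True\<close> serves for the diagonal, which
  avoids the excluded index with all four bits \<open>False\<close>.\<close>

lemma pure_types_differ:
  assumes "diag_prod B \<noteq> antidiag_prod B" "diag_prod B' \<noteq> antidiag_prod B'"
    and "\<And>x y z w. x \<or> y \<or> z \<or> w \<Longrightarrow> (x = y) = (z = w) \<Longrightarrow> B x y * B' z w = 0"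
  shows "(\<forall>x. B x x = 0) \<and> (\<forall>x. B' x (\<not> x) = 0) \<or> (\<forall>x. B x (\<not> x) = 0) \<and> (\<forall>x. B' x x = 0)"
  using assms(1,2) assms(3)[of True True True True] assms(3)[of False False True True]
    assms(3)[of True True False False] assms(3)[of True False True False] assms(3)[of True False False True]
    assms(3)[of False True True False] assms(3)[of False True False True]
  by (auto simp: diag_prod_def antidiag_prod_def all_bool_eq)

text \<open>The same argument with the diagonal of one form set against the antidiagonal of the
  other.\<close>

lemma pure_types_agree:
  assumes "diag_prod B \<noteq> antidiag_prod B" "diag_prod B' \<noteq> antidiag_prod B'"
    and "\<And>x y z w. (x = y) \<noteq> (z = w) \<Longrightarrow> B x y * B' z w = 0"
  shows "(\<forall>x. B x x = 0) \<and> (\<forall>x. B' x x = 0) \<or> (\<forall>x. B x (\<not> x) = 0) \<and> (\<forall>x. B' x (\<not> x) = 0)"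
  using assms(1,2) assms(3)[of True True True False] assms(3)[of False False True False]
    assms(3)[of True True False True] assms(3)[of False False False True] assms(3)[of True False True True]
    assms(3)[of True False False False] assms(3)[of False True True True] assms(3)[of False True False False]
  by (auto simp: diag_prod_def antidiag_prod_def all_bool_eq)

lemma entries_nonzero:
  assumes "diag_prod B \<noteq> antidiag_prod B" "diag_prod B' \<noteq> antidiag_prod B'"
    and "diag_prod B * diag_prod B' = antidiag_prod B * antidiag_prod B'"
    and "antidiag_prod B * diag_prod B' = diag_prod B * antidiag_prod B'"
  shows "B x y \<noteq> 0" "B' x y \<noteq> 0"
proof -
  \<comment> \<open>Difference and sum of the two equations factor; nondegeneracy cancels one factor
    in each.\<close>
  have "(diag_prod B - antidiag_prod B) * (diag_prod B' + antidiag_prod B') = 0"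
    "(diag_prod B + antidiag_prod B) * (diag_prod B' - antidiag_prod B') = 0"
    using assms(3,4) by (simp_all add: algebra_simps)
  then have "diag_prod B' = - antidiag_prod B'" "diag_prod B = - antidiag_prod B"
    using assms(1,2) by (simp_all add: add_eq_0_iff2)
  then have "diag_prod B \<noteq> 0" "antidiag_prod B \<noteq> 0" "diag_prod B' \<noteq> 0" "antidiag_prod B' \<noteq> 0"
    using assms(1,2) by auto
  then show "B x y \<noteq> 0" "B' x y \<noteq> 0"
    by (cases x; cases y; auto simp: diag_prod_def antidiag_prod_def)+
qed

text \<open>The case analysis, detached from tensors. The facts \<open>e12\<close> to
  \<open>o34\<close> come from the relations in positions 1, 2, 3, 4 and 5, 6, 7, 8, and
  \<open>s\<close> from positions 1, 2, 3, 5; \<open>par\<close> says that the index has even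
  weight. The test \<open>(x = y) = (z = w)\<close> means that the four bits have even sum.\<close>

lemma even_pair_prod_zero:
  assumes d: "\<And>B. B \<in> {B1, B2, B3, B4} \<Longrightarrow> diag_prod B \<noteq> antidiag_prod B"
    and e12: "\<And>x y z w. x \<or> y \<or> z \<or> w \<Longrightarrow> (x = y) = (z = w) \<Longrightarrow> B3 x y * B4 z w \<noteq> 0 \<Longrightarrow>
      diag_prod B1 * diag_prod B2 = antidiag_prod B1 * antidiag_prod B2"
    and o12: "\<And>x y z w. (x = y) \<noteq> (z = w) \<Longrightarrow> B3 x y * B4 z w \<noteq> 0 \<Longrightarrow>
      antidiag_prod B1 * diag_prod B2 = diag_prod B1 * antidiag_prod B2"
    and e34: "\<And>x y z w. x \<or> y \<or> z \<or> w \<Longrightarrow> (x = y) = (z = w) \<Longrightarrow> B1 x y * B2 z w \<noteq> 0 \<Longrightarrow>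
      diag_prod B3 * diag_prod B4 = antidiag_prod B3 * antidiag_prod B4"
    and o34: "\<And>x y z w. (x = y) \<noteq> (z = w) \<Longrightarrow> B1 x y * B2 z w \<noteq> 0 \<Longrightarrow>
      antidiag_prod B3 * diag_prod B4 = diag_prod B3 * antidiag_prod B4"
    and s: "B2 False True * B2 True True * B3 False True * B3 True True * B4 True True = 0"
    and par: "((x1 = x3) = (x2 = x4)) = ((x5 = x7) = (x6 = x8))"
  shows "B1 x1 x3 * B2 x2 x4 * B3 x5 x7 * B4 x6 x8 = 0"
proof -
  have d': "diag_prod B1 \<noteq> antidiag_prod B1" "diag_prod B2 \<noteq> antidiag_prod B2"
    "diag_prod B3 \<noteq> antidiag_prod B3" "diag_prod B4 \<noteq> antidiag_prod B4" using d by blast+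
  have nd: "diag_prod B = 0" if "\<forall>x. B x x = 0" for B using that by (simp add: diag_prod_def)
  have na: "antidiag_prod B = 0" if "\<forall>x. B x (\<not> x) = 0" for B
    using that by (simp add: antidiag_prod_def all_bool_eq)
  have z: "B x y = 0" if "\<forall>x. B x x = 0" "x = y" for B :: "bool \<Rightarrow> bool \<Rightarrow> complex" and x y
    using that by simp
  have z': "B x y = 0" if "\<forall>x. B x (\<not> x) = 0" "x \<noteq> y" for B :: "bool \<Rightarrow> bool \<Rightarrow> complex" and x y
    using that by (cases x; cases y; simp add: all_bool_eq)
  have differ: "B x y * B' z w = 0"
    if "(\<forall>x. B x x = 0) \<and> (\<forall>x. B' x (\<not> x) = 0) \<or> (\<forall>x. B x (\<not> x) = 0) \<and> (\<forall>x. B' x x = 0)"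
      "(x = y) = (z = w)" for B B' :: "bool \<Rightarrow> bool \<Rightarrow> complex" and x y z w
    using that(1)
  proof (elim disjE conjE)
    assume "\<forall>x. B x x = 0" "\<forall>x. B' x (\<not> x) = 0"
    then show ?thesis using z[of B x y] z'[of B' z w] that(2) by (cases "x = y") simp_all
  next
    assume "\<forall>x. B x (\<not> x) = 0" "\<forall>x. B' x x = 0"
    then show ?thesis using z'[of B x y] z[of B' z w] that(2) by (cases "x = y") simp_all
  qed
  have agree: "B x y * B' z w = 0"
    if "(\<forall>x. B x x = 0) \<and> (\<forall>x. B' x x = 0) \<or> (\<forall>x. B x (\<not> x) = 0) \<and> (\<forall>x. B' x (\<not> x) = 0)"
      "(x = y) \<noteq> (z = w)" for B B' :: "bool \<Rightarrow> bool \<Rightarrow> complex" and x y z w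
    using that(1)
  proof (elim disjE conjE)
    assume "\<forall>x. B x x = 0" "\<forall>x. B' x x = 0"
    then show ?thesis using z[of B x y] z[of B' z w] that(2) by (cases "x = y") simp_all
  next
    assume "\<forall>x. B x (\<not> x) = 0" "\<forall>x. B' x (\<not> x) = 0"
    then show ?thesis using z'[of B x y] z'[of B' z w] that(2) by (cases "x = y") simp_all
  qed
  have split: "B1 x1 x3 * B2 x2 x4 * B3 x5 x7 * B4 x6 x8 = (B1 x1 x3 * B2 x2 x4) * (B3 x5 x7 * B4 x6 x8)"
    by simp
  consider "diag_prod B1 * diag_prod B2 = antidiag_prod B1 * antidiag_prod B2"
      "antidiag_prod B1 * diag_prod B2 = diag_prod B1 * antidiag_prod B2"
    | "diag_prod B1 * diag_prod B2 \<noteq> antidiag_prod B1 * antidiag_prod B2"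
    | "antidiag_prod B1 * diag_prod B2 \<noteq> diag_prod B1 * antidiag_prod B2" by blast
  then show ?thesis
  proof cases
    case 1
    note n12 = entries_nonzero[OF d'(1,2) 1]
    \<comment> \<open>All entries of \<open>B1\<close> and \<open>B2\<close> are nonzero, so any
      admissible even and odd index will do.\<close>
    have "diag_prod B3 * diag_prod B4 = antidiag_prod B3 * antidiag_prod B4"
      by (rule e34[of True True True True]) (simp_all add: n12)
    moreover have "antidiag_prod B3 * diag_prod B4 = diag_prod B3 * antidiag_prod B4"
      by (rule o34[of True True False True]) (simp_all add: n12)
    ultimately have n34: "B3 x y \<noteq> 0" "B4 x y \<noteq> 0" for x y
      by (rule entries_nonzero[OF d'(3,4)])+
    then show ?thesis using s by (simp add: n12 n34)
  next
    case 2
    \<comment> \<open>By contraposition of \<open>e12\<close>, the even-weight entries of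
      \<open>B3\<close> and \<open>B4\<close> vanish, except possibly at the index with all bits
      \<open>False\<close>.\<close>
    have t34: "(\<forall>x. B3 x x = 0) \<and> (\<forall>x. B4 x (\<not> x) = 0) \<or> (\<forall>x. B3 x (\<not> x) = 0) \<and> (\<forall>x. B4 x x = 0)"
    proof (rule pure_types_differ[OF d'(3,4)])
      show "B3 x y * B4 z w = 0" if "x \<or> y \<or> z \<or> w" "(x = y) = (z = w)" for x y z w
        using e12[OF that] 2 by argo
    qed
    \<comment> \<open>For forms of different pure types exactly one side of this equation is zero.
      Hence \<open>o34\<close> kills the odd-weight entries for \<open>B1\<close> and
      \<open>B2\<close>, and the whole product lives in odd weight.\<close>
    then have c: "antidiag_prod B3 * diag_prod B4 \<noteq> diag_prod B3 * antidiag_prod B4"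
      using d'(3,4) nd[of B3] nd[of B4] na[of B3] na[of B4] by (elim disjE conjE) simp_all
    have t12: "(\<forall>x. B1 x x = 0) \<and> (\<forall>x. B2 x x = 0) \<or> (\<forall>x. B1 x (\<not> x) = 0) \<and> (\<forall>x. B2 x (\<not> x) = 0)"
    proof (rule pure_types_agree[OF d'(1,2)])
      show "B1 x y * B2 z w = 0" if "(x = y) \<noteq> (z = w)" for x y z w
        using o34[OF that] c by argo
    qed
    show ?thesis
      using differ[OF t34, of x5 x7 x6 x8] agree[OF t12, of x1 x3 x2 x4] par unfolding split
      by (cases "(x5 = x7) = (x6 = x8)") (simp_all only: mult_zero_left mult_zero_right simp_thms)
  next
    case 3
    \<comment> \<open>The same argument with the parities of the two halves exchanged.\<close>
    have t34: "(\<forall>x. B3 x x = 0) \<and> (\<forall>x. B4 x x = 0) \<or> (\<forall>x. B3 x (\<not> x) = 0) \<and> (\<forall>x. B4 x (\<not> x) = 0)"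
    proof (rule pure_types_agree[OF d'(3,4)])
      show "B3 x y * B4 z w = 0" if "(x = y) \<noteq> (z = w)" for x y z w
        using o12[OF that] 3 by argo
    qed
    then have c: "diag_prod B3 * diag_prod B4 \<noteq> antidiag_prod B3 * antidiag_prod B4"
      using d'(3,4) nd[of B3] nd[of B4] na[of B3] na[of B4] by (elim disjE conjE) simp_all
    have t12: "(\<forall>x. B1 x x = 0) \<and> (\<forall>x. B2 x (\<not> x) = 0) \<or> (\<forall>x. B1 x (\<not> x) = 0) \<and> (\<forall>x. B2 x x = 0)"
    proof (rule pure_types_differ[OF d'(1,2)])
      show "B1 x y * B2 z w = 0" if "x \<or> y \<or> z \<or> w" "(x = y) = (z = w)" for x y z w
        using e34[OF that] c by argo
    qed
    show ?thesis
      using agree[OF t34, of x5 x7 x6 x8] differ[OF t12, of x1 x3 x2 x4] par unfolding split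
      by (cases "(x5 = x7) = (x6 = x8)") (simp_all only: mult_zero_left mult_zero_right simp_thms)
  qed
qed

lemma even_card_iff:
  assumes "J \<subseteq> {1..8::nat}"
  shows "even (card J) \<longleftrightarrow>
    (((1 \<in> J) = (3 \<in> J)) = ((2 \<in> J) = (4 \<in> J))) = (((5 \<in> J) = (7 \<in> J)) = ((6 \<in> J) = (8 \<in> J)))"
proof -
  have "card J = (\<Sum>k\<in>{1..8}. if k \<in> J then 1 else 0)"
    using assms by (simp add: sum.If_cases Int_absorb1 Int_def[symmetric])
  also have "{1..8::nat} = {1,2,3,4,5,6,7,8}" by auto
  finally have "card J = (\<Sum>k\<in>{1,2,3,4,5,6,7,8}. if k \<in> J then 1 else 0)" .
  moreover have "even (if P then 1 else 0 :: nat) \<longleftrightarrow> \<not> P" for P by simp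
  ultimately have "even (card J) \<longleftrightarrow> ((1 \<notin> J) = ((2 \<notin> J) = ((3 \<notin> J) = ((4 \<notin> J) = ((5 \<notin> J) =
      ((6 \<notin> J) = ((7 \<notin> J) = (8 \<notin> J))))))))"
    by (simp only: sum.insert finite.intros sum.empty even_add insert_iff) simp
  then show ?thesis by argo
qed

text \<open>Substituting a product of forms into a relation in positions 1, 2, 3, 4 factors out the
  square of the fixed entry of \<open>B3\<close> and \<open>B4\<close>, leaving twice A1 A2 - C1 C2
  in even weight and twice C1 A2 - A1 C2 in odd weight, where A and C are the diagonal and
  antidiagonal products. This supplies the hypotheses of \<open>even_pair_prod_zero\<close>.\<close>

lemma even_proj_pair_prod_zero:
  assumes \<beta>: "\<beta> \<in> pf_cone 8"
    and eq: "\<And>J. J \<subseteq> {1..8} \<Longrightarrow> \<beta> J = (if even (card J) then pair_prod B1 B2 B3 B4 J else 0)"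
    and d: "\<And>B. B \<in> {B1, B2, B3, B4} \<Longrightarrow> diag_prod B \<noteq> antidiag_prod B"
    and J: "J \<subseteq> {1..8}"
  shows "\<beta> J = 0"
proof -
  let ?v34 = "\<lambda>S. B3 (5 \<in> S) (7 \<in> S) * B4 (6 \<in> S) (8 \<in> S)"
  let ?v12 = "\<lambda>S. B1 (1 \<in> S) (3 \<in> S) * B2 (2 \<in> S) (4 \<in> S)"
  let ?par = "\<lambda>J. (((1 \<in> J) = (3 \<in> J)) = ((2 \<in> J) = (4 \<in> J))) = (((5 \<in> J) = (7 \<in> J)) = ((6 \<in> J) = (8 \<in> J)))"
  have eq': "\<beta> J = (if ?par J then pair_prod B1 B2 B3 B4 J else 0)" if "J \<subseteq> {1..8}" for J
    using eq[OF that] even_card_iff[OF that] by simp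
  have r12: "even_rel 1 2 3 4 (\<lambda>X. \<beta> (S \<union> X)) = 0" "odd_rel 1 2 3 4 (\<lambda>X. \<beta> (S \<union> X)) = 0"
    if S: "S \<subseteq> {5..8}" "S \<noteq> {}" for S
  proof -
    let ?R = "{1..8} - {1, 2, 3, 4} - S"
    \<comment> \<open>A nonempty \<open>S\<close> leaves a base of at most three elements.\<close>
    have "?R \<subset> {5..8}" using S by auto
    then have "card ?R < card {5..8::nat}" by (intro psubset_card_mono) auto
    then have "card ?R \<le> 3" by simp
    moreover have "\<forall>r\<in>?R. 4 < r" by auto
    moreover have "S \<subseteq> {1..8}" "S \<inter> {1, 2, 3, 4} = {}" using S by auto
    ultimately show "even_rel 1 2 3 4 (\<lambda>X. \<beta> (S \<union> X)) = 0" "odd_rel 1 2 3 4 (\<lambda>X. \<beta> (S \<union> X)) = 0"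
      using pf_cone_rel[OF \<beta>, of 1 2 3 4 S ?R] by simp_all
  qed
  have r34: "even_rel 5 6 7 8 (\<lambda>X. \<beta> (S \<union> X)) = 0" "odd_rel 5 6 7 8 (\<lambda>X. \<beta> (S \<union> X)) = 0"
    if S: "S \<subseteq> {1..4}" "S \<noteq> {}" for S
  proof -
    let ?R = "{1..8} - {5, 6, 7, 8} - S"
    have "?R \<subset> {1..4}" using S by auto
    then have "card ?R < card {1..4::nat}" by (intro psubset_card_mono) auto
    then have "card ?R \<le> 3" by simp
    moreover have "\<forall>r\<in>?R. r < 5" by auto
    moreover have "S \<subseteq> {1..8}" "S \<inter> {5, 6, 7, 8} = {}" using S by auto
    ultimately show "even_rel 5 6 7 8 (\<lambda>X. \<beta> (S \<union> X)) = 0" "odd_rel 5 6 7 8 (\<lambda>X. \<beta> (S \<union> X)) = 0"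
      using pf_cone_rel[OF \<beta>, of 5 6 7 8 S ?R] by simp_all
  qed
  \<comment> \<open>The arguments follow the pairs: bits at 5, 7, 6, 8 here, and at 1, 3, 2, 4 in
    \<open>S12\<close>.\<close>
  define S34 :: "bool \<Rightarrow> bool \<Rightarrow> bool \<Rightarrow> bool \<Rightarrow> nat set"
    where "S34 = (\<lambda>x y z w. {k. k = 5 \<and> x \<or> k = 7 \<and> y \<or> k = 6 \<and> z \<or> k = 8 \<and> w})"
  define S12 :: "bool \<Rightarrow> bool \<Rightarrow> bool \<Rightarrow> bool \<Rightarrow> nat set"
    where "S12 = (\<lambda>x y z w. {k. k = 1 \<and> x \<or> k = 3 \<and> y \<or> k = 2 \<and> z \<or> k = 4 \<and> w})"
  have ev34: "\<beta> (S34 x y z w \<union> X) = (if ((1 \<in> X) = (3 \<in> X)) = ((2 \<in> X) = (4 \<in> X)) \<longleftrightarrow> (x = y) = (z = w)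
      then B1 (1 \<in> X) (3 \<in> X) * B2 (2 \<in> X) (4 \<in> X) * (B3 x y * B4 z w) else 0)"
    if "X \<subseteq> {1..4}" for x y z w X
  proof -
    have m: "1 \<in> S34 x y z w \<union> X \<longleftrightarrow> 1 \<in> X" "2 \<in> S34 x y z w \<union> X \<longleftrightarrow> 2 \<in> X"
      "3 \<in> S34 x y z w \<union> X \<longleftrightarrow> 3 \<in> X" "4 \<in> S34 x y z w \<union> X \<longleftrightarrow> 4 \<in> X"
      "5 \<in> S34 x y z w \<union> X \<longleftrightarrow> x" "7 \<in> S34 x y z w \<union> X \<longleftrightarrow> y"
      "6 \<in> S34 x y z w \<union> X \<longleftrightarrow> z" "8 \<in> S34 x y z w \<union> X \<longleftrightarrow> w"
      using that by (auto simp: S34_def)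
    have "S34 x y z w \<union> X \<subseteq> {1..8}" using that by (auto simp: S34_def)
    then show ?thesis by (simp only: eq' pair_prod_def m mult.assoc)
  qed
  have ev12: "\<beta> (S12 x y z w \<union> X) = (if (x = y) = (z = w) \<longleftrightarrow> ((5 \<in> X) = (7 \<in> X)) = ((6 \<in> X) = (8 \<in> X))
      then B3 (5 \<in> X) (7 \<in> X) * B4 (6 \<in> X) (8 \<in> X) * (B1 x y * B2 z w) else 0)"
    if "X \<subseteq> {5..8}" for x y z w X
  proof -
    have m: "1 \<in> S12 x y z w \<union> X \<longleftrightarrow> x" "3 \<in> S12 x y z w \<union> X \<longleftrightarrow> y"
      "2 \<in> S12 x y z w \<union> X \<longleftrightarrow> z" "4 \<in> S12 x y z w \<union> X \<longleftrightarrow> w"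
      "5 \<in> S12 x y z w \<union> X \<longleftrightarrow> 5 \<in> X" "6 \<in> S12 x y z w \<union> X \<longleftrightarrow> 6 \<in> X"
      "7 \<in> S12 x y z w \<union> X \<longleftrightarrow> 7 \<in> X" "8 \<in> S12 x y z w \<union> X \<longleftrightarrow> 8 \<in> X"
      using that by (auto simp: S12_def)
    have "S12 x y z w \<union> X \<subseteq> {1..8}" using that by (auto simp: S12_def)
    then show ?thesis by (simp only: eq' pair_prod_def m mult_ac)
  qed
  have e12: "diag_prod B1 * diag_prod B2 = antidiag_prod B1 * antidiag_prod B2"
    if "x \<or> y \<or> z \<or> w" "(x = y) = (z = w)" "B3 x y * B4 z w \<noteq> 0" for x y z w
  proof -
    have "S34 x y z w \<subseteq> {5..8}" "S34 x y z w \<noteq> {}" using that(1) by (auto simp: S34_def)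
    then have "even_rel 1 2 3 4 (\<lambda>X. \<beta> (S34 x y z w \<union> X)) = 0" by (rule r12)
    moreover have "even_rel 1 2 3 4 (\<lambda>X. \<beta> (S34 x y z w \<union> X)) =
      2 * (B3 x y * B4 z w)\<^sup>2 * (diag_prod B1 * diag_prod B2 - antidiag_prod B1 * antidiag_prod B2)"
      using that(2) by (simp add: even_rel_def ev34 ev34[of "{}", unfolded Un_empty_right] diag_prod_def antidiag_prod_def power2_eq_square algebra_simps
        del: One_nat_def Un_insert_right)
    ultimately show ?thesis using that(3) by simp
  qed
  have o12: "antidiag_prod B1 * diag_prod B2 = diag_prod B1 * antidiag_prod B2"
    if "(x = y) \<noteq> (z = w)" "B3 x y * B4 z w \<noteq> 0" for x y z w
  proof -
    \<comment> \<open>An odd number of set bits already makes the set nonempty.\<close>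
    have "S34 x y z w \<subseteq> {5..8}" "S34 x y z w \<noteq> {}" using that(1) by (auto simp: S34_def)
    then have "odd_rel 1 2 3 4 (\<lambda>X. \<beta> (S34 x y z w \<union> X)) = 0" by (rule r12)
    moreover have "odd_rel 1 2 3 4 (\<lambda>X. \<beta> (S34 x y z w \<union> X)) =
      2 * (B3 x y * B4 z w)\<^sup>2 * (antidiag_prod B1 * diag_prod B2 - diag_prod B1 * antidiag_prod B2)"
      using that(1) by (simp add: odd_rel_def ev34 ev34[of "{}", unfolded Un_empty_right] diag_prod_def antidiag_prod_def power2_eq_square algebra_simps
        del: One_nat_def Un_insert_right)
    ultimately show ?thesis using that(2) by simp
  qed
  have e34: "diag_prod B3 * diag_prod B4 = antidiag_prod B3 * antidiag_prod B4"
    if "x \<or> y \<or> z \<or> w" "(x = y) = (z = w)" "B1 x y * B2 z w \<noteq> 0" for x y z w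
  proof -
    have "S12 x y z w \<subseteq> {1..4}" "S12 x y z w \<noteq> {}" using that(1) by (auto simp: S12_def)
    then have "even_rel 5 6 7 8 (\<lambda>X. \<beta> (S12 x y z w \<union> X)) = 0" by (rule r34)
    moreover have "even_rel 5 6 7 8 (\<lambda>X. \<beta> (S12 x y z w \<union> X)) =
      2 * (B1 x y * B2 z w)\<^sup>2 * (diag_prod B3 * diag_prod B4 - antidiag_prod B3 * antidiag_prod B4)"
      using that(2) by (simp add: even_rel_def ev12 ev12[of "{}", unfolded Un_empty_right] diag_prod_def antidiag_prod_def power2_eq_square algebra_simps
        del: One_nat_def Un_insert_right)
    ultimately show ?thesis using that(3) by simp
  qed
  have o34: "antidiag_prod B3 * diag_prod B4 = diag_prod B3 * antidiag_prod B4"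
    if "(x = y) \<noteq> (z = w)" "B1 x y * B2 z w \<noteq> 0" for x y z w
  proof -
    have "S12 x y z w \<subseteq> {1..4}" "S12 x y z w \<noteq> {}" using that(1) by (auto simp: S12_def)
    then have "odd_rel 5 6 7 8 (\<lambda>X. \<beta> (S12 x y z w \<union> X)) = 0" by (rule r34)
    moreover have "odd_rel 5 6 7 8 (\<lambda>X. \<beta> (S12 x y z w \<union> X)) =
      2 * (B1 x y * B2 z w)\<^sup>2 * (antidiag_prod B3 * diag_prod B4 - diag_prod B3 * antidiag_prod B4)"
      using that(1) by (simp add: odd_rel_def ev12 ev12[of "{}", unfolded Un_empty_right] diag_prod_def antidiag_prod_def power2_eq_square algebra_simps
        del: One_nat_def Un_insert_right)
    ultimately show ?thesis using that(2) by simp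
  qed
  have s: "B2 False True * B2 True True * B3 False True * B3 True True * B4 True True = 0"
  proof -
    \<comment> \<open>This quadruple cuts across the pairs (2, 4) and (5, 7). The set {4, 6, 7, 8}
      is its whole complement, so the base is empty and the order condition on it is
      vacuous.\<close>
    have "even_rel 1 2 3 5 (\<lambda>X. \<beta> ({4, 6, 7, 8} \<union> X)) = 0"
      by (rule pf_cone_rel(1)[OF \<beta>, where R = "{}"]) auto
    moreover have "even_rel 1 2 3 5 (\<lambda>X. \<beta> ({4, 6, 7, 8} \<union> X)) =
      2 * B2 False True * B2 True True * B3 False True * B3 True True * (B4 True True)\<^sup>2
        * (diag_prod B1 - antidiag_prod B1)"
      by (simp add: even_rel_def eq' pair_prod_def diag_prod_def antidiag_prod_def power2_eq_square algebra_simps)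
    ultimately show ?thesis using d[of B1] by auto
  qed
  show ?thesis
  proof (cases "?par J")
    case True
    have "B1 (1 \<in> J) (3 \<in> J) * B2 (2 \<in> J) (4 \<in> J) * B3 (5 \<in> J) (7 \<in> J) * B4 (6 \<in> J) (8 \<in> J) = 0"
      using d e12 o12 e34 o34 s True by (rule even_pair_prod_zero)
    then show ?thesis using eq'[OF J] by (simp add: pair_prod_def)
  next
    case False
    then show ?thesis by (simp only: eq'[OF J] if_False)
  qed
qed

section \<open>The orbits of the swap tensor\<close>

definition bit :: "bool \<Rightarrow> 2" where
  "bit b = (if b then 1 else 0)"

text \<open>The matrix product of the transpose of \<open>h\<close> with \<open>k\<close>: the
  standard form, a sum of v_s^* tensor v_s^*, pulled back along \<open>h\<close> and
  \<open>k\<close>.\<close>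

definition pair_form :: "complex^2^2 \<Rightarrow> complex^2^2 \<Rightarrow> bool \<Rightarrow> bool \<Rightarrow> complex" where
  "pair_form h k x y = (\<Sum>s\<in>UNIV. h $ bit s $ bit x * k $ bit s $ bit y)"

lemma pair_form_det:
  "diag_prod (pair_form h k) - antidiag_prod (pair_form h k) = det h * det k"
proof -
  \<comment> \<open>The formula \<open>det_2\<close> uses the indices 1 and 2, and 2 is the element
    0 of the index type.\<close>
  have two: "(2::2) = 0" by simp
  show ?thesis
    by (simp add: diag_prod_def antidiag_prod_def pair_form_def UNIV_bool bit_def det_2 two algebra_simps)
qed

lemma SWAP_eq:
  assumes "J \<subseteq> {1..4}" "(1 \<in> J) = (3 \<in> J)" "(2 \<in> J) = (4 \<in> J)"
  shows "SWAP J = 1"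
proof -
  have J: "J = {} \<or> J = {2, 4} \<or> J = {1, 3} \<or> J = {1, 2, 3, 4}"
  proof -
    have "J \<subseteq> {1, 2, 3, 4}" using assms(1) by force
    then show ?thesis using assms(2,3) by (cases "1 \<in> J"; cases "2 \<in> J") auto
  qed
  have a: "{k \<in> {1..length [0,0,0,0]}. [0,0,0,0] ! (k - 1) = (1::nat)} = {}"
    "{k \<in> {1..length [0,1,0,1]}. [0,1,0,1] ! (k - 1) = (1::nat)} = {2, 4}"
    "{k \<in> {1..length [1,0,1,0]}. [1,0,1,0] ! (k - 1) = (1::nat)} = {1, 3}"
    "{k \<in> {1..length [1,1,1,1]}. [1,1,1,1] ! (k - 1) = (1::nat)} = {1, 2, 3, 4}"
    by (auto simp: nth_Cons' split: if_splits)
  have "SWAP J = bra {} J + bra {2, 4} J + bra {1, 3} J + bra {1, 2, 3, 4} J"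
    unfolding SWAP_def bra_bits_def a ..
  also have "\<dots> = 1"
  proof -
    have "{2, 4} \<noteq> {1, 3::nat}" "{2, 4} \<noteq> {1, 2, 3, 4::nat}" "{1, 3} \<noteq> {1, 2, 3, 4::nat}" by auto
    then show ?thesis using J by (elim disjE) (simp_all add: bra_def)
  qed
  finally show ?thesis .
qed

text \<open>Parametrizes the support of \<open>G_SWAP\<close> by one bit for each pair of positions;
  the tuple argument lets a sum over the support split into four sums over bits.\<close>

definition doubled :: "bool \<times> bool \<times> bool \<times> bool \<Rightarrow> nat set" where
  "doubled = (\<lambda>(s1, s2, s3, s4). {k. (k = 1 \<or> k = 3) \<and> s1 \<or> (k = 2 \<or> k = 4) \<and> s2
     \<or> (k = 5 \<or> k = 7) \<and> s3 \<or> (k = 6 \<or> k = 8) \<and> s4})"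

lemma doubled_mem:
  "k \<in> doubled (s1, s2, s3, s4) \<longleftrightarrow> (k = 1 \<or> k = 3) \<and> s1 \<or> (k = 2 \<or> k = 4) \<and> s2
     \<or> (k = 5 \<or> k = 7) \<and> s3 \<or> (k = 6 \<or> k = 8) \<and> s4"
  by (simp add: doubled_def)

lemma inj_doubled: "inj doubled"
proof (rule injI)
  fix s t assume e: "doubled s = doubled t"
  obtain s1 s2 s3 s4 t1 t2 t3 t4 where st: "s = (s1, s2, s3, s4)" "t = (t1, t2, t3, t4)"
    by (metis surj_pair)
  have "1 \<in> doubled s \<longleftrightarrow> 1 \<in> doubled t" "2 \<in> doubled s \<longleftrightarrow> 2 \<in> doubled t"
    "5 \<in> doubled s \<longleftrightarrow> 5 \<in> doubled t" "6 \<in> doubled s \<longleftrightarrow> 6 \<in> doubled t" using e by simp_all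
  then show "s = t" by (simp add: st doubled_mem)
qed

lemma doubled_subset: "doubled s \<subseteq> {1..8}"
  by (auto simp: doubled_def split: prod.splits)

lemma G_SWAP_doubled: "G_SWAP (doubled s) = 1"
proof -
  obtain s1 s2 s3 s4 where s: "s = (s1, s2, s3, s4)" by (metis surj_pair)
  have "SWAP (doubled s \<inter> {1..4}) = 1" by (rule SWAP_eq) (simp_all add: s doubled_mem)
  moreover have "SWAP {j \<in> {1..4}. j + 4 \<in> doubled s} = 1"
  proof (rule SWAP_eq)
    show "{j \<in> {1..4}. j + 4 \<in> doubled s} \<subseteq> {1..4}" by blast
  qed (simp_all add: s doubled_mem)
  ultimately show ?thesis using doubled_subset[of s] by (simp add: G_SWAP_def tensor_prod_def)
qed

lemma G_SWAP_support: "G_SWAP J \<noteq> 0 \<Longrightarrow> J \<in> range doubled"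
proof -
  assume "G_SWAP J \<noteq> 0"
  note n = G_SWAP_nz[OF this]
  let ?D = "doubled (1 \<in> J, 2 \<in> J, 5 \<in> J, 6 \<in> J)"
  have e: "{1..8::nat} = {1,2,3,4,5,6,7,8}" by auto
  have m: "1 \<in> ?D \<longleftrightarrow> 1 \<in> J" "3 \<in> ?D \<longleftrightarrow> 1 \<in> J" "2 \<in> ?D \<longleftrightarrow> 2 \<in> J" "4 \<in> ?D \<longleftrightarrow> 2 \<in> J"
    "5 \<in> ?D \<longleftrightarrow> 5 \<in> J" "7 \<in> ?D \<longleftrightarrow> 5 \<in> J" "6 \<in> ?D \<longleftrightarrow> 6 \<in> J" "8 \<in> ?D \<longleftrightarrow> 6 \<in> J"
    by (simp_all add: doubled_mem)
  have "\<forall>k\<in>{1..8}. k \<in> J \<longleftrightarrow> k \<in> ?D"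
    unfolding e ball_simps m using n by blast
  moreover have "J \<subseteq> {1..8}" "?D \<subseteq> {1..8}" using n doubled_subset by simp_all
  ultimately have "J = ?D" by blast
  then show ?thesis by (rule range_eqI)
qed

lemma chi_bit: "chi I k = bit (k \<in> I)"
  by (simp add: chi_def bit_def)

text \<open>Only the sets in the range of \<open>doubled\<close> contribute, each with coefficient
  1. The product over the positions groups by pairs, so the sum over four bits factors into four
  sums, each an entry of a \<open>pair_form\<close>.\<close>

lemma act_G_SWAP:
  assumes "J \<subseteq> {1..8}"
  shows "act 8 g G_SWAP J = pair_prod
    (pair_form (matrix_inv (g 1)) (matrix_inv (g 3))) (pair_form (matrix_inv (g 2)) (matrix_inv (g 4)))
    (pair_form (matrix_inv (g 5)) (matrix_inv (g 7))) (pair_form (matrix_inv (g 6)) (matrix_inv (g 8))) J"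
proof -
  define h where "h k s = matrix_inv (g k) $ bit s $ bit (k \<in> J)" for k s
  let ?F = "\<lambda>K. G_SWAP K * (\<Prod>k=1..8. matrix_inv (g k) $ chi K k $ chi J k)"
  have i: "{1..8::nat} = {1,2,3,4,5,6,7,8}" by auto
  have "act 8 g G_SWAP J = sum ?F (Pow {1..8})" using assms by (simp add: act_def)
  also have "\<dots> = sum ?F (range doubled)"
  proof (rule sum.mono_neutral_right)
    show "range doubled \<subseteq> Pow {1..8}" using doubled_subset by blast
    show "\<forall>K\<in>Pow {1..8} - range doubled. ?F K = 0"
      using G_SWAP_support by (metis DiffD2 mult_eq_0_iff)
  qed simp
  also have "\<dots> = (\<Sum>s\<in>UNIV. ?F (doubled s))"
    using inj_doubled by (simp add: sum.reindex)
  also have "\<dots> = (\<Sum>s1\<in>UNIV. \<Sum>s2\<in>UNIV. \<Sum>s3\<in>UNIV. \<Sum>s4\<in>UNIV. ?F (doubled (s1, s2, s3, s4)))"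
    by (simp only: UNIV_Times_UNIV[symmetric] sum.cartesian_product')
  also have "\<dots> = (\<Sum>s1\<in>UNIV. \<Sum>s2\<in>UNIV. \<Sum>s3\<in>UNIV. \<Sum>s4\<in>UNIV.
      (h 1 s1 * h 3 s1) * ((h 2 s2 * h 4 s2) * ((h 5 s3 * h 7 s3) * (h 6 s4 * h 8 s4))))"
  proof (intro sum.cong refl)
    fix s1 s2 s3 s4
    let ?D = "doubled (s1, s2, s3, s4)"
    have m: "1 \<in> ?D \<longleftrightarrow> s1" "3 \<in> ?D \<longleftrightarrow> s1" "2 \<in> ?D \<longleftrightarrow> s2" "4 \<in> ?D \<longleftrightarrow> s2"
      "5 \<in> ?D \<longleftrightarrow> s3" "7 \<in> ?D \<longleftrightarrow> s3" "6 \<in> ?D \<longleftrightarrow> s4" "8 \<in> ?D \<longleftrightarrow> s4"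
      by (simp_all add: doubled_mem)
    have "?F ?D = (\<Prod>k\<in>{1,2,3,4,5,6,7,8}. matrix_inv (g k) $ bit (k \<in> ?D) $ bit (k \<in> J))"
      unfolding G_SWAP_doubled chi_bit i by (rule mult_1_left)
    also have "\<dots> = (h 1 s1 * h 3 s1) * ((h 2 s2 * h 4 s2) * ((h 5 s3 * h 7 s3) * (h 6 s4 * h 8 s4)))"
      by (simp add: m h_def mult_ac del: One_nat_def)
    finally show "?F ?D = (h 1 s1 * h 3 s1) * ((h 2 s2 * h 4 s2) * ((h 5 s3 * h 7 s3) * (h 6 s4 * h 8 s4)))" .
  qed
  also have "\<dots> = (\<Sum>s\<in>UNIV. h 1 s * h 3 s) * ((\<Sum>s\<in>UNIV. h 2 s * h 4 s) *
      ((\<Sum>s\<in>UNIV. h 5 s * h 7 s) * (\<Sum>s\<in>UNIV. h 6 s * h 8 s)))"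
    by (simp only: sum_distrib_left[symmetric] sum_distrib_right[symmetric])
  finally show ?thesis by (simp add: pair_prod_def pair_form_def h_def mult.assoc)
qed

lemma det_matrix_inv:
  fixes A :: "complex^2^2"
  assumes "invertible A" shows "det A * det (matrix_inv A) = 1"
proof -
  have "\<exists>B. A ** B = mat 1 \<and> B ** A = mat 1" using assms by (simp add: invertible_def)
  then have "A ** matrix_inv A = mat 1" unfolding matrix_inv_def by (rule someI2_ex) blast
  then show ?thesis using det_mul[of A "matrix_inv A"] by (simp add: det_I)
qed

definition form_det :: "(bool \<Rightarrow> bool \<Rightarrow> complex) \<Rightarrow> complex" where
  "form_det B = diag_prod B - antidiag_prod B"

lemma GL2_orbit_pair_prod:
  assumes "T \<in> orbit 8 GL2 G_SWAP"
  obtains B1 B2 B3 B4 where "\<And>J. J \<subseteq> {1..8} \<Longrightarrow> T J = pair_prod B1 B2 B3 B4 J"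
    "\<And>B. B \<in> {B1, B2, B3, B4} \<Longrightarrow> form_det B \<noteq> 0"
proof -
  obtain g where T: "T = act 8 g G_SWAP" and g: "\<forall>k\<in>{1..8}. invertible (g k)"
    using assms by (auto simp: orbit_def GL2_def)
  let ?P = "\<lambda>i j. pair_form (matrix_inv (g i)) (matrix_inv (g j))"
  have "form_det (?P i j) \<noteq> 0" if "i \<in> {1..8}" "j \<in> {1..8}" for i j
    using g det_matrix_inv[of "g i"] det_matrix_inv[of "g j"] that
    by (auto simp: form_det_def pair_form_det)
  then have "form_det B \<noteq> 0" if "B \<in> {?P 1 3, ?P 2 4, ?P 5 7, ?P 6 8}" for B using that by auto
  then show ?thesis using act_G_SWAP[of _ g, folded T] by (intro that)
qed

lemma SL2_orbit_pair_prod: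
  assumes "T \<in> orbit 8 SL2 G_SWAP"
  obtains B1 B2 B3 B4 where "\<And>J. J \<subseteq> {1..8} \<Longrightarrow> T J = pair_prod B1 B2 B3 B4 J"
    "\<And>B. B \<in> {B1, B2, B3, B4} \<Longrightarrow> form_det B = 1"
proof -
  obtain g where T: "T = act 8 g G_SWAP" and g: "\<forall>k\<in>{1..8}. det (g k) = 1"
    using assms by (auto simp: orbit_def SL2_def)
  let ?P = "\<lambda>i j. pair_form (matrix_inv (g i)) (matrix_inv (g j))"
  have "det (matrix_inv (g i)) = 1" if "i \<in> {1..8}" for i
    using g det_matrix_inv[of "g i"] that by (simp add: invertible_det_nz)
  then have "form_det (?P i j) = 1" if "i \<in> {1..8}" "j \<in> {1..8}" for i j
    using that by (simp add: form_det_def pair_form_det)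
  then have "form_det B = 1" if "B \<in> {?P 1 3, ?P 2 4, ?P 5 7, ?P 6 8}" for B using that by auto
  then show ?thesis using act_G_SWAP[of _ g, folded T] by (intro that)
qed

section \<open>Factorization on the Zariski closure of the orbit\<close>

lemma zariski_closureD:
  assumes "T \<in> zariski_closure n S" "f \<in> poly_funs n" "\<And>\<sigma>. \<sigma> \<in> S \<Longrightarrow> f \<sigma> = 0"
  shows "f T = 0"
  using assms unfolding zariski_closure_def by blast

text \<open>For a product of forms, exchanging the bits of \<open>J\<close> and \<open>K\<close> on
  one pair only swaps one factor between the two values. These are the binomial equations of
  decomposable tensors, and being polynomial they persist on the closure.\<close>

lemma closure_exchange:
  assumes T: "T \<in> zariski_closure 8 (orbit 8 SL2 G_SWAP)" and JK: "J \<subseteq> {1..8}" "K \<subseteq> {1..8}"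
    and D: "D \<in> {{1, 3}, {2, 4}, {5, 7}, {6, 8}}"
  shows "T J * T K = T ((K - D) \<union> (J \<inter> D)) * T ((J - D) \<union> (K \<inter> D))"
proof -
  let ?J = "(J - D) \<union> (K \<inter> D)" and ?K = "(K - D) \<union> (J \<inter> D)"
  have JK': "?J \<subseteq> {1..8}" "?K \<subseteq> {1..8}" using JK by blast+
  have "T J * T K - T ?K * T ?J = 0"
  proof (rule zariski_closureD[OF T])
    show "(\<lambda>\<beta>. \<beta> J * \<beta> K - \<beta> ?K * \<beta> ?J) \<in> poly_funs 8"
      by (intro poly_funs_diff poly_funs.mult poly_funs.coord JK JK')
    fix \<sigma> assume "\<sigma> \<in> orbit 8 SL2 G_SWAP"
    then obtain B1 B2 B3 B4 where s: "\<And>J. J \<subseteq> {1..8} \<Longrightarrow> \<sigma> J = pair_prod B1 B2 B3 B4 J"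
      "\<And>B. B \<in> {B1, B2, B3, B4} \<Longrightarrow> form_det B = 1"
      by (rule SL2_orbit_pair_prod) blast
    have "pair_prod B1 B2 B3 B4 J * pair_prod B1 B2 B3 B4 K =
        pair_prod B1 B2 B3 B4 ?K * pair_prod B1 B2 B3 B4 ?J"
      using D by (elim insertE emptyE) (simp_all add: pair_prod_def del: One_nat_def)
    then show "\<sigma> J * \<sigma> K - \<sigma> ?K * \<sigma> ?J = 0" by (simp only: s(1) JK JK') simp
  qed
  then show ?thesis by simp
qed

text \<open>Sets bits only at the second positions of the pairs. In the complement all first
  positions are set and the second bits are negated, so each pair contributes one term of a
  determinant expansion.\<close>

definition upper :: "bool \<Rightarrow> bool \<Rightarrow> bool \<Rightarrow> bool \<Rightarrow> nat set" where
  "upper x1 x2 x3 x4 = {k. k = 3 \<and> x1 \<or> k = 4 \<and> x2 \<or> k = 7 \<and> x3 \<or> k = 8 \<and> x4}"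

definition sgb :: "bool \<Rightarrow> complex" where
  "sgb x = (if x then -1 else 1)"

text \<open>
  A quadratic form whose value at a product of four bilinear forms is the product of their
  determinants; it keeps the determinants away from zero on the Zariski closure.
\<close>

definition det_form :: "tensor \<Rightarrow> complex" where
  "det_form T = (\<Sum>x1\<in>UNIV. \<Sum>x2\<in>UNIV. \<Sum>x3\<in>UNIV. \<Sum>x4\<in>UNIV.
     (sgb x1 * (sgb x2 * (sgb x3 * sgb x4))) * (T (upper x1 x2 x3 x4) * T ({1..8} - upper x1 x2 x3 x4)))"

lemma upper_subset: "upper x1 x2 x3 x4 \<subseteq> {1..8}"
  by (auto simp: upper_def)

lemma det_form_poly: "det_form \<in> poly_funs 8"
proof -
  have "(\<lambda>T. det_form T) \<in> poly_funs 8"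
    unfolding det_form_def
    by (intro poly_funs_sum poly_funs.mult poly_funs.coord poly_funs.const upper_subset Diff_subset)
  then show ?thesis by simp
qed

lemma det_form_pair_prod:
  assumes "\<And>J. J \<subseteq> {1..8} \<Longrightarrow> T J = pair_prod B1 B2 B3 B4 J"
  shows "det_form T = form_det B1 * (form_det B2 * (form_det B3 * form_det B4))"
proof -
  \<comment> \<open>The sign of a term of the two-by-two determinant is determined by the column
    chosen in the row \<open>False\<close>.\<close>
  have f: "form_det B = (\<Sum>x\<in>UNIV. sgb x * (B False x * B True (\<not> x)))" for B
    by (simp add: form_det_def diag_prod_def antidiag_prod_def UNIV_bool sgb_def)
  have "(sgb x1 * (sgb x2 * (sgb x3 * sgb x4))) * (T (upper x1 x2 x3 x4) * T ({1..8} - upper x1 x2 x3 x4)) =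
      sgb x1 * (B1 False x1 * B1 True (\<not> x1)) * (sgb x2 * (B2 False x2 * B2 True (\<not> x2)) *
      (sgb x3 * (B3 False x3 * B3 True (\<not> x3)) * (sgb x4 * (B4 False x4 * B4 True (\<not> x4)))))"
    for x1 x2 x3 x4
  proof -
    let ?U = "upper x1 x2 x3 x4"
    have "T ?U = pair_prod B1 B2 B3 B4 ?U" "T ({1..8} - ?U) = pair_prod B1 B2 B3 B4 ({1..8} - ?U)"
      by (rule assms, rule upper_subset) (rule assms, rule Diff_subset)
    moreover have m: "1 \<in> ?U \<longleftrightarrow> False" "2 \<in> ?U \<longleftrightarrow> False" "5 \<in> ?U \<longleftrightarrow> False" "6 \<in> ?U \<longleftrightarrow> False"
      "3 \<in> ?U \<longleftrightarrow> x1" "4 \<in> ?U \<longleftrightarrow> x2" "7 \<in> ?U \<longleftrightarrow> x3" "8 \<in> ?U \<longleftrightarrow> x4" by (simp_all add: upper_def)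
    moreover have "1 \<in> {1..8} - ?U \<longleftrightarrow> True" "2 \<in> {1..8} - ?U \<longleftrightarrow> True" "5 \<in> {1..8} - ?U \<longleftrightarrow> True"
      "6 \<in> {1..8} - ?U \<longleftrightarrow> True" "3 \<in> {1..8} - ?U \<longleftrightarrow> \<not> x1" "4 \<in> {1..8} - ?U \<longleftrightarrow> \<not> x2"
      "7 \<in> {1..8} - ?U \<longleftrightarrow> \<not> x3" "8 \<in> {1..8} - ?U \<longleftrightarrow> \<not> x4" by (simp_all add: upper_def)
    ultimately show ?thesis by (simp only: pair_prod_def mult_ac)
  qed
  then show ?thesis
    unfolding f det_form_def by (simp only: sum_distrib_left[symmetric] sum_distrib_right[symmetric])
qed

text \<open>The value 1 of \<open>det_form\<close> on the orbit persists on the closure. It makes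
  \<open>T\<close> nonzero, which gives a reference index for the factorization, and then keeps each
  of the four determinants nonzero.\<close>

lemma closure_pair_prod:
  assumes T: "T \<in> zariski_closure 8 (orbit 8 SL2 G_SWAP)"
  obtains B1 B2 B3 B4 where "\<And>J. J \<subseteq> {1..8} \<Longrightarrow> T J = pair_prod B1 B2 B3 B4 J"
    "\<And>B. B \<in> {B1, B2, B3, B4} \<Longrightarrow> form_det B \<noteq> 0"
proof -
  have "det_form T - 1 = 0"
  proof (rule zariski_closureD[OF T])
    show "(\<lambda>\<beta>. det_form \<beta> - 1) \<in> poly_funs 8"
      by (intro poly_funs_diff det_form_poly poly_funs.const)
    fix \<sigma> assume "\<sigma> \<in> orbit 8 SL2 G_SWAP"
    then obtain B1 B2 B3 B4 where "\<And>J. J \<subseteq> {1..8} \<Longrightarrow> \<sigma> J = pair_prod B1 B2 B3 B4 J"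
      "\<And>B. B \<in> {B1, B2, B3, B4} \<Longrightarrow> form_det B = 1"
      by (rule SL2_orbit_pair_prod) blast
    then show "det_form \<sigma> - 1 = 0" using det_form_pair_prod[of \<sigma> B1 B2 B3 B4] by simp
  qed
  then have q: "det_form T = 1" by simp
  obtain J0 where J0: "J0 \<subseteq> {1..8}" "T J0 \<noteq> 0"
  proof (rule ccontr)
    assume "\<not> thesis"
    then have "T J = 0" if "J \<subseteq> {1..8}" for J using that \<open>\<And>J0. J0 \<subseteq> {1..8} \<Longrightarrow> T J0 \<noteq> 0 \<Longrightarrow> thesis\<close> by blast
    then have "det_form T = 0" using upper_subset by (simp add: det_form_def)
    then show False using q by simp
  qed
  define c where "c = T J0"
  \<comment> \<open>The slice of \<open>T\<close> in which only the bits at \<open>i\<close> and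
    \<open>j\<close> vary and the others are frozen at \<open>J0\<close>.\<close>
  define B where "B i j x y = T ((J0 - {i, j}) \<union> {k. k = i \<and> x \<or> k = j \<and> y})" for i j and x y :: bool
  have step: "T J * c = B i j (i \<in> J) (j \<in> J) * T ((J - {i, j}) \<union> (J0 \<inter> {i, j}))"
    if "J \<subseteq> {1..8}" "{i, j} \<in> {{1, 3}, {2, 4}, {5, 7}, {6, 8}}" for J i j
  proof -
    have "{k. k = i \<and> i \<in> J \<or> k = j \<and> j \<in> J} = J \<inter> {i, j}" by blast
    then show ?thesis using closure_exchange[OF T that(1) J0(1) that(2)] by (simp add: B_def c_def)
  qed
  \<comment> \<open>Three exchanges against \<open>J0\<close> each cost a factor \<open>c\<close>,
    so three of the four slices are divided by \<open>c\<close>.\<close>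
  have prod: "T J = pair_prod (\<lambda>x y. B 1 3 x y / c) (\<lambda>x y. B 2 4 x y / c) (\<lambda>x y. B 5 7 x y / c) (B 6 8) J"
    if J: "J \<subseteq> {1..8}" for J
  proof -
    \<comment> \<open>The pairs of \<open>J\<close> are replaced one after another by those of
      \<open>J0\<close>.\<close>
    define J1 where "J1 = (J - {1, 3}) \<union> (J0 \<inter> {1, 3})"
    define J2 where "J2 = (J1 - {2, 4}) \<union> (J0 \<inter> {2, 4})"
    define J3 where "J3 = (J2 - {5, 7}) \<union> (J0 \<inter> {5, 7})"
    have s: "J1 \<subseteq> {1..8}" using J J0(1) unfolding J1_def by blast
    have s2: "J2 \<subseteq> {1..8}" using s J0(1) unfolding J2_def by blast
    have s3: "J3 \<subseteq> {1..8}" using s2 J0(1) unfolding J3_def by blast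
    have e: "{1..8::nat} = {1,3} \<union> {2,4} \<union> {5,7} \<union> {6,8}" by auto
    have "(J3 - {6, 8}) \<union> (J0 \<inter> {6, 8}) = J0"
      using J J0(1) unfolding e J3_def J2_def J1_def by blast
    then have "T J3 * c = B 6 8 (6 \<in> J) (8 \<in> J) * c"
      using step[OF s3, of 6 8] by (simp add: J1_def J2_def J3_def c_def)
    then have "T J3 = B 6 8 (6 \<in> J) (8 \<in> J)" using J0(2) by (simp add: c_def)
    moreover have "T J * c = B 1 3 (1 \<in> J) (3 \<in> J) * T J1"
      using step[OF J, of 1 3] by (simp add: J1_def)
    moreover have "T J1 * c = B 2 4 (2 \<in> J) (4 \<in> J) * T J2"
      using step[OF s, of 2 4] by (simp add: J1_def J2_def)
    moreover have "T J2 * c = B 5 7 (5 \<in> J) (7 \<in> J) * T J3"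
      using step[OF s2, of 5 7] by (simp add: J1_def J2_def J3_def)
    moreover have "c \<noteq> 0" using J0(2) by (simp add: c_def)
    ultimately have "T J2 = B 5 7 (5 \<in> J) (7 \<in> J) / c * B 6 8 (6 \<in> J) (8 \<in> J)"
      "T J1 = B 2 4 (2 \<in> J) (4 \<in> J) / c * T J2" "T J = B 1 3 (1 \<in> J) (3 \<in> J) / c * T J1"
      by (simp_all add: nonzero_eq_divide_eq)
    then show ?thesis by (simp only: pair_prod_def mult.assoc)
  qed
  moreover have "form_det B' \<noteq> 0"
    if "B' \<in> {\<lambda>x y. B 1 3 x y / c, \<lambda>x y. B 2 4 x y / c, \<lambda>x y. B 5 7 x y / c, B 6 8}" for B'
    proof
    assume z: "form_det B' = 0"
    have "det_form T = form_det (\<lambda>x y. B 1 3 x y / c) * (form_det (\<lambda>x y. B 2 4 x y / c) *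
        (form_det (\<lambda>x y. B 5 7 x y / c) * form_det (B 6 8)))"
      by (rule det_form_pair_prod) (rule prod)
    then have "det_form T = 0" using that z by auto
    then show False using q by simp
  qed
  ultimately show ?thesis by (rule that)
qed

text \<open>The common last step for the closure of one orbit and for the other orbit: both supply
  such a factorization of \<open>T\<close>.\<close>

lemma even_proj_pf_cone_zero:
  assumes "\<And>J. J \<subseteq> {1..8} \<Longrightarrow> T J = pair_prod B1 B2 B3 B4 J"
    "\<And>B. B \<in> {B1, B2, B3, B4} \<Longrightarrow> form_det B \<noteq> 0"
    and \<beta>: "even_proj T \<in> pf_cone 8"
  shows "even_proj T = (\<lambda>I. 0)"
proof
  fix J
  show "even_proj T J = 0"
  proof (cases "J \<subseteq> {1..8}")
    case True
    show ?thesis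
    proof (rule even_proj_pair_prod_zero[OF \<beta> _ _ True])
      show "even_proj T J = (if even (card J) then pair_prod B1 B2 B3 B4 J else 0)"
        if "J \<subseteq> {1..8}" for J using assms(1)[OF that] by (simp add: even_proj_def)
      show "diag_prod B \<noteq> antidiag_prod B" if "B \<in> {B1, B2, B3, B4}" for B
        using assms(2)[OF that] by (simp add: form_det_def)
    qed
  next
    case False
    then show ?thesis using \<beta> by (simp add: pf_cone_def tensors_def)
  qed
qed

theorem theorem4p6:
  "(even_proj ` zariski_closure 8 (orbit 8 SL2 G_SWAP) \<inter> pf_cone 8) - {\<lambda>I. 0}
     = even_proj ` orbit 8 GL2 G_SWAP \<inter> pf_scaled 8
   \<and> even_proj ` orbit 8 GL2 G_SWAP \<inter> pf_scaled 8 = {}"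
proof -
  have "even_proj T = (\<lambda>I. 0)"
    if "T \<in> zariski_closure 8 (orbit 8 SL2 G_SWAP)" "even_proj T \<in> pf_cone 8" for T
    using that(1) by (rule closure_pair_prod) (rule even_proj_pf_cone_zero[OF _ _ that(2)])
  \<comment> \<open>Scaled cogates lie in the cone, so the projection would again be zero; but zero
    is not a nonzero multiple of a cogate.\<close>
  moreover have "even_proj T \<notin> pf_scaled 8" if "T \<in> orbit 8 GL2 G_SWAP" for T
  proof
    assume s: "even_proj T \<in> pf_scaled 8"
    then have c: "even_proj T \<in> pf_cone 8" using pf_scaled_subset_pf_cone by blast
    have "even_proj T = (\<lambda>I. 0)"
      using that by (rule GL2_orbit_pair_prod) (rule even_proj_pf_cone_zero[OF _ _ c])
    then show False using s zero_notin_pf_scaled by simp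
  qed
  ultimately have "even_proj ` zariski_closure 8 (orbit 8 SL2 G_SWAP) \<inter> pf_cone 8 \<subseteq> {\<lambda>I. 0}"
    "even_proj ` orbit 8 GL2 G_SWAP \<inter> pf_scaled 8 = {}"
    by auto
  then show ?thesis by (metis Diff_eq_empty_iff)
qed

end
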